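(* Let $K$ be a field and let $f_1,\dots,f_r\in K[x_1,\dots,x_n]$ ($n,r\ge1$) be homogeneous polynomials of degrees $d_1,\dots,d_r\ge 1$. Suppose that $f_1,\dots,f_r$ have no common zero in $\mathbf{P}^{n-1}$. Let $(\Omega^\bullet_{K[x,y]/K},\partial)$ be the bigraded complex with $\partial(\omega)=dF\wedge\omega$, $F=\sum_{j=1}^r y_jf_j$ (see context). Then $$H^k(\Omega^\bullet_{K[x,y]/K})^{(0,p)}=0\quad\text{for }k\ne 2n\text{ and all }p,$$ and $$\dim_K H^{2n}(\Omega^\bullet_{K[x,y]/K})^{(0,p)}=\begin{cases}1&\text{if }p=n,\\0&\text{otherwise.}\end{cases}$$
   Context: "No common zero in $\mathbf{P}^{n-1}$" means no common zero over an algebraic closure of $K$; equivalently, the ideal $(f_1,\dots,f_r)$ has depth $n$ (in particular $r\ge n$). No restriction is made on the characteristic of $K$. Let $K[x,y]=K[x_1,\dots,x_n,y_1,\dots,y_r]$ and $F=y_1f_1+\cdots+y_rf_r$. $\Omega^k_{K[x,y]/K}$ is the module of Kähler differential $k$-forms: the free $K[x,y]$-module on the forms $dx_{i_1}\wedge\cdots\wedge dx_{i_l}\wedge dy_{j_1}\wedge\cdots\wedge dy_{j_m}$ with $i_1<\cdots<i_l$, $j_1<\cdots<j_m$, $l+m=k$. The boundary map is $\partial(\omega)=dF\wedge\omega$, where $dF$ is the exterior derivative of $F$. Bigrading $(\deg_1,\deg_2)$: $x_i$ and $dx_i$ have bidegree $(1,0)$; $y_j$ and $dy_j$ have bidegree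 $(-d_j,1)$. The superscript $(q,p)$ denotes the component with $\deg_1=q$, $\deg_2=p$. The map $\partial$ has bidegree $(0,1)$, and $H^k(\Omega^\bullet_{K[x,y]/K})^{(q,p)}$ is the kernel of $\partial$ on $(\Omega^k_{K[x,y]/K})^{(q,p)}$ modulo $\partial\big((\Omega^{k-1}_{K[x,y]/K})^{(q,p-1)}\big)$. *)

theory Defs
  imports
    "HOL-Library.Poly_Mapping"
    "HOL-Algebra.Algebraic_Closure_Type"
    "HOL-Algebra.AbelCoset"
    "Jordan_Normal_Form.VS_Connect"
begin

section \<open>Multivariate polynomials\<close>

text \<open>
  Monomials are finitely supported exponent vectors \<^typ>\<open>nat \<Rightarrow>\<^sub>0 nat\<close>, and
  \<^typ>\<open>(nat \<Rightarrow>\<^sub>0 nat) \<Rightarrow>\<^sub>0 'k\<close> carries the convolution product, i.e. it is the polynomial ring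
  over \<open>'k\<close> in variables indexed by \<^typ>\<open>nat\<close>. The polynomial ring in finitely many
  variables is the set of polynomials with \<open>mvars p \<subseteq> {..<N}\<close>.

  Numbering of the variables of \<open>K[x, y]\<close>, counting from \<open>0\<close>:
  \<open>x\<^sub>i\<close> is variable \<open>i\<close> for \<open>i < n\<close>, and \<open>y\<^sub>j\<close> is variable \<open>n + j\<close> for \<open>j < r\<close>.
\<close>

type_synonym 'k mpol = "(nat \<Rightarrow>\<^sub>0 nat) \<Rightarrow>\<^sub>0 'k"

definition mconst :: "'k \<Rightarrow> 'k::zero mpol" where
  "mconst c = Poly_Mapping.single 0 c"

definition mvar :: "nat \<Rightarrow> 'k::zero_neq_one mpol" where
  "mvar i = Poly_Mapping.single (Poly_Mapping.single i 1) 1"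

definition mvars :: "'k::zero mpol \<Rightarrow> nat set" where
  "mvars p = (\<Union>m\<in>Poly_Mapping.keys p. Poly_Mapping.keys m)"

definition mpderiv :: "nat \<Rightarrow> 'k::comm_semiring_1 mpol \<Rightarrow> 'k mpol" where
  "mpderiv i p = (\<Sum>m\<in>Poly_Mapping.keys p.
     Poly_Mapping.single (m - Poly_Mapping.single i 1)
       (of_nat (Poly_Mapping.lookup m i) * Poly_Mapping.lookup p m))"

text \<open>The zero polynomial is homogeneous of every degree.\<close>

definition mhomogeneous :: "nat \<Rightarrow> 'k::zero mpol \<Rightarrow> bool" where
  "mhomogeneous e p \<longleftrightarrow>
     (\<forall>m\<in>Poly_Mapping.keys p. (\<Sum>i\<in>Poly_Mapping.keys m. Poly_Mapping.lookup m i) = e)"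

definition meval_ac :: "(nat \<Rightarrow> 'k alg_closure) \<Rightarrow> 'k::field mpol \<Rightarrow> 'k alg_closure" where
  "meval_ac a p = (\<Sum>m\<in>Poly_Mapping.keys p. to_ac (Poly_Mapping.lookup p m) *
     (\<Prod>i\<in>Poly_Mapping.keys m. a i ^ Poly_Mapping.lookup m i))"

text \<open>
  A point of projective \<open>(n-1)\<close>-space over the algebraic closure is given by homogeneous
  coordinates \<open>a 0, \<dots>, a (n-1)\<close>, not all zero; later values of \<open>a\<close> are irrelevant for
  polynomials in the first \<open>n\<close> variables.
\<close>

definition no_common_zero :: "nat \<Rightarrow> nat \<Rightarrow> (nat \<Rightarrow> 'k::field mpol) \<Rightarrow> bool" where
  "no_common_zero n r f \<longleftrightarrow>
     \<not> (\<exists>a :: nat \<Rightarrow> 'k alg_closure. (\<exists>i<n. a i \<noteq> 0) \<and> (\<forall>j<r. meval_ac a (f j) = 0))"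

section \<open>Differential forms\<close>

text \<open>
  A form is given by its coefficients: \<open>\<omega> I\<close> is the coefficient of
  \<open>dv\<^bsub>i\<^sub>1\<^esub> \<and> \<dots> \<and> dv\<^bsub>i\<^sub>k\<^esub>\<close>, where \<open>I = {i\<^sub>1 < \<dots> < i\<^sub>k}\<close>. As the \<open>x\<close>-variables
  precede the \<open>y\<close>-variables, these are the basis forms \<open>dx\<^sub>I \<and> dy\<^sub>J\<close>.
\<close>

type_synonym 'k dform = "nat set \<Rightarrow> 'k mpol"

text \<open>
  \<open>kforms N k\<close> is the module of Kaehler \<open>k\<close>-forms of the polynomial ring in \<open>N\<close> variables.
  The degree is an integer, so that \<open>kforms N (- 1)\<close> is the zero module.
\<close>

definition kforms :: "nat \<Rightarrow> int \<Rightarrow> 'k::zero dform set" where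
  "kforms N k = {\<omega>. \<forall>I. \<omega> I \<noteq> 0 \<longrightarrow>
     I \<subseteq> {..<N} \<and> int (card I) = k \<and> mvars (\<omega> I) \<subseteq> {..<N}}"

text \<open>
  For disjoint \<open>A\<close>, \<open>B\<close> one has \<open>dv\<^sub>A \<and> dv\<^sub>B = (-1)\<^sup>s dv\<^bsub>A \<union> B\<^esub>\<close> with
  \<open>s\<close> the number of pairs \<open>(a, b) \<in> A \<times> B\<close> with \<open>b < a\<close>; for non-disjoint ones the product is \<open>0\<close>.
\<close>

definition inversions :: "nat set \<Rightarrow> nat set \<Rightarrow> nat" where
  "inversions A B = card {(a, b). a \<in> A \<and> b \<in> B \<and> b < a}"

definition wedge :: "'k::comm_ring_1 dform \<Rightarrow> 'k dform \<Rightarrow> 'k dform" where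
  "wedge \<alpha> \<beta> = (\<lambda>I. \<Sum>A\<in>Pow I. (- 1) ^ inversions A (I - A) * \<alpha> A * \<beta> (I - A))"

definition ext_deriv :: "'k::comm_ring_1 mpol \<Rightarrow> 'k dform" where
  "ext_deriv p = (\<lambda>I. if is_singleton I then mpderiv (the_elem I) p else 0)"

definition Fpoly :: "nat \<Rightarrow> nat \<Rightarrow> (nat \<Rightarrow> 'k::comm_ring_1 mpol) \<Rightarrow> 'k mpol" where
  "Fpoly n r f = (\<Sum>j<r. mvar (n + j) * f j)"

definition bdry :: "nat \<Rightarrow> nat \<Rightarrow> (nat \<Rightarrow> 'k::comm_ring_1 mpol) \<Rightarrow> 'k dform \<Rightarrow> 'k dform" where
  "bdry n r f \<omega> = wedge (ext_deriv (Fpoly n r f)) \<omega>"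

section \<open>The bigrading\<close>

definition vdeg1 :: "nat \<Rightarrow> (nat \<Rightarrow> nat) \<Rightarrow> nat \<Rightarrow> int" where
  "vdeg1 n d v = (if v < n then 1 else - int (d (v - n)))"

definition vdeg2 :: "nat \<Rightarrow> nat \<Rightarrow> int" where
  "vdeg2 n v = (if v < n then 0 else 1)"

text \<open>Degree of \<open>m dv\<^sub>I\<close> for a monomial \<open>m\<close>, when both \<open>v\<close> and \<open>dv\<close> have degree \<open>w v\<close>.\<close>

definition term_deg :: "(nat \<Rightarrow> int) \<Rightarrow> (nat \<Rightarrow>\<^sub>0 nat) \<Rightarrow> nat set \<Rightarrow> int" where
  "term_deg w m I = (\<Sum>v\<in>Poly_Mapping.keys m. int (Poly_Mapping.lookup m v) * w v) + (\<Sum>v\<in>I. w v)"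

definition biforms ::
  "nat \<Rightarrow> nat \<Rightarrow> (nat \<Rightarrow> nat) \<Rightarrow> int \<Rightarrow> int \<Rightarrow> int \<Rightarrow> 'k::zero dform set" where
  "biforms n r d k q p = {\<omega> \<in> kforms (n + r) k. \<forall>I. \<forall>m\<in>Poly_Mapping.keys (\<omega> I).
     term_deg (vdeg1 n d) m I = q \<and> term_deg (vdeg2 n) m I = p}"

section \<open>Cohomology\<close>

definition form_space :: "'k::comm_ring_1 dform set \<Rightarrow> ('k, 'k dform) module" where
  "form_space W = \<lparr>carrier = W, monoid.mult = undefined, one = undefined,
     zero = (\<lambda>I. 0), add = (\<lambda>\<alpha> \<beta> I. \<alpha> I + \<beta> I), module.smult = (\<lambda>c \<alpha> I. mconst c * \<alpha> I)\<rparr>"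

text \<open>
  The quotient module \<open>V / W\<close>, with cosets as elements. The multiplicative fields of the record
  are not used for modules.
\<close>

definition quot_module :: "('c, 'v, 'x) module_scheme \<Rightarrow> 'v set \<Rightarrow> ('c, 'v set) module" where
  "quot_module V W = \<lparr>carrier = a_rcosets\<^bsub>V\<^esub> W, monoid.mult = undefined, one = undefined,
     zero = W, add = set_add V, module.smult = (\<lambda>c C. \<Union>x\<in>C. W +>\<^bsub>V\<^esub> (c \<odot>\<^bsub>V\<^esub> x))\<rparr>"

definition cocycles ::
  "nat \<Rightarrow> nat \<Rightarrow> (nat \<Rightarrow> nat) \<Rightarrow> (nat \<Rightarrow> 'k::comm_ring_1 mpol) \<Rightarrow> int \<Rightarrow> int \<Rightarrow> int \<Rightarrow> 'k dform set" where
  "cocycles n r d f k q p = {\<omega> \<in> biforms n r d k q p. bdry n r f \<omega> = (\<lambda>I. 0)}"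

definition coboundaries ::
  "nat \<Rightarrow> nat \<Rightarrow> (nat \<Rightarrow> nat) \<Rightarrow> (nat \<Rightarrow> 'k::comm_ring_1 mpol) \<Rightarrow> int \<Rightarrow> int \<Rightarrow> int \<Rightarrow> 'k dform set" where
  "coboundaries n r d f k q p = bdry n r f ` biforms n r d (k - 1) q (p - 1)"

definition cohomology ::
  "nat \<Rightarrow> nat \<Rightarrow> (nat \<Rightarrow> nat) \<Rightarrow> (nat \<Rightarrow> 'k::comm_ring_1 mpol) \<Rightarrow> int \<Rightarrow> int \<Rightarrow> int
    \<Rightarrow> ('k, 'k dform set) module" where
  "cohomology n r d f k q p =
     quot_module (form_space (cocycles n r d f k q p)) (coboundaries n r d f k q p)"

end

theory Submission
  imports Defs "HOL-Library.Function_Algebras"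
begin

text \<open>
  By the Nullstellensatz there are \<open>N\<close> and \<open>h\<^bsub>lj\<^esub>\<close> with
  \<open>x\<^sub>l\<^sup>N = \<Sum>\<^sub>j h\<^bsub>lj\<^esub> f\<^sub>j\<close> for every \<open>l\<close>. As \<open>f\<^sub>j\<close> is the coefficient of \<open>dy\<^sub>j\<close> in \<open>dF\<close>,
  contraction with the vector field \<open>\<Sum>\<^sub>j h\<^bsub>lj\<^esub> \<partial>/\<partial>y\<^sub>j\<close> is a null-homotopy of multiplication by
  \<open>x\<^sub>l\<^sup>N\<close>. Let \<open>\<Omega>\<^sub>m = \<Omega> / (x\<^sub>1\<^sup>N, \<dots>, x\<^sub>m\<^sup>N) \<Omega>\<close>. The long exact sequence of multiplication by
  \<open>x\<^bsub>m+1\<^esub>\<^sup>N\<close> on \<open>\<Omega>\<^sub>m\<close> therefore splits into short exact sequences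
  \<open>0 \<rightarrow> H\<^sup>k(\<Omega>\<^sub>m)\<^bsup>(q,p)\<^esup> \<rightarrow> H\<^sup>k(\<Omega>\<^bsub>m+1\<^esub>)\<^bsup>(q,p)\<^esup> \<rightarrow> H\<^bsup>k+1\<^esup>(\<Omega>\<^sub>m)\<^bsup>(q-N,p+1)\<^esup> \<rightarrow> 0\<close>. For \<open>m = n\<close> the part
  of \<open>\<Omega>\<^sub>n\<close> with \<open>deg\<^sub>1 \<ge> nN\<close> is spanned by \<open>(x\<^sub>1 \<cdots> x\<^sub>n)\<^bsup>N-1\<^esup> dx\<^sub>1 \<cdots> dx\<^sub>n\<close>, of degree \<open>nN\<close>. Descending
  induction on \<open>m\<close> shows that the cohomology of \<open>\<Omega>\<^sub>m\<close> vanishes for \<open>deg\<^sub>1 > mN\<close>, and that for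
  \<open>deg\<^sub>1 = mN\<close> it is one-dimensional, concentrated in \<open>k = 2n - m\<close>, \<open>p = n - m\<close>.

  For the Nullstellensatz, induct on the number of variables. Since \<open>(0, \<dots>, 0, 1)\<close> is not a zero,
  a homogeneous ideal without nontrivial zeros contains a polynomial monic in the last variable, so
  no change of coordinates is needed; Nakayama's lemma then extends zeros of the elimination ideal.
\<close>

section \<open>Multivariate polynomials\<close>

abbreviation lookup where "lookup \<equiv> Poly_Mapping.lookup"
abbreviation keys where "keys \<equiv> Poly_Mapping.keys"
abbreviation single where "single \<equiv> Poly_Mapping.single"

lemma mpol_eq_sum_single: "p = (\<Sum>m\<in>keys p. single m (lookup p m))"
  by (rule poly_mapping_eqI)
    (auto simp: lookup_sum lookup_single when_def in_keys_iff)

text \<open>The base case is limited to monomials of the given polynomial, so hypotheses about its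
  support can be used there without being part of \<open>P\<close>.\<close>

lemma mpol_induct [case_names single add zero]:
  assumes "\<And>m c. m \<in> keys p \<Longrightarrow> P (single m c)"
    and "\<And>p q. P p \<Longrightarrow> P q \<Longrightarrow> P (p + q)" and "P 0"
  shows "P (p :: 'k::comm_monoid_add mpol)"
proof -
  have "P (\<Sum>m\<in>A. single m (lookup p m))" if "finite A" "A \<subseteq> keys p" for A
    using that by (induction A) (auto intro: assms)
  from this[of "keys p"] show ?thesis
    by (simp flip: mpol_eq_sum_single)
qed

lemma mpol_mult_eq:
  "(p :: 'k::comm_semiring_1 mpol) * q =
     (\<Sum>a\<in>keys p. \<Sum>b\<in>keys q. single (a + b) (lookup p a * lookup q b))"
proof -
  have "p * q = (\<Sum>m\<in>keys p. single m (lookup p m)) * (\<Sum>m\<in>keys q. single m (lookup q m))"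
    by (simp flip: mpol_eq_sum_single)
  then show ?thesis by (simp add: sum_product mult_single)
qed

section \<open>Restriction of a polynomial to a set of monomials\<close>

lift_definition mrestrict :: "'a set \<Rightarrow> ('a \<Rightarrow>\<^sub>0 'k::zero) \<Rightarrow> 'a \<Rightarrow>\<^sub>0 'k"
  is "\<lambda>S f m. if m \<in> S then f m else 0"
  by (rule rev_finite_subset) auto

lemma lookup_mrestrict: "lookup (mrestrict S p) m = (if m \<in> S then lookup p m else 0)"
  by transfer simp

lemma keys_mrestrict: "keys (mrestrict S p) = keys p \<inter> S"
  by (auto simp: in_keys_iff lookup_mrestrict split: if_splits)

lemma mrestrict_add: "mrestrict S (p + q) = mrestrict S p + mrestrict S (q :: 'k::comm_monoid_add mpol)"
  by (rule poly_mapping_eqI) (simp add: lookup_mrestrict lookup_add)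

lemma mrestrict_0 [simp]: "mrestrict S 0 = 0"
  by (rule poly_mapping_eqI) (simp add: lookup_mrestrict)

lemma mrestrict_sum: "mrestrict S (sum f A) = (\<Sum>i\<in>A. mrestrict S (f i :: 'k::comm_monoid_add mpol))"
  by (induction A rule: infinite_finite_induct) (auto simp: mrestrict_add)

lemma mrestrict_ident: "keys p \<subseteq> S \<Longrightarrow> mrestrict S p = p"
  by (rule poly_mapping_eqI) (auto simp: lookup_mrestrict in_keys_iff)

lemma mrestrict_disjoint: "keys p \<inter> S = {} \<Longrightarrow> mrestrict S p = 0"
  by (rule poly_mapping_eqI) (auto simp: lookup_mrestrict in_keys_iff)

lemma mrestrict_compl: "mrestrict S p + mrestrict (- S) p = (p :: 'k::comm_monoid_add mpol)"
  by (rule poly_mapping_eqI) (auto simp: lookup_mrestrict lookup_add)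

text \<open>Split \<open>b\<close> into its parts inside and outside \<open>T\<close>:
  multiplication by \<open>a\<close> sends the first entirely into \<open>S\<close> and the second
  entirely out of it. Applied to graded pieces, this says that a homogeneous factor commutes with
  taking components.\<close>

lemma mrestrict_mult:
  fixes a b :: "'k::comm_semiring_1 mpol"
  assumes "\<And>m m'. m \<in> keys a \<Longrightarrow> m + m' \<in> S \<longleftrightarrow> m' \<in> T"
  shows "mrestrict S (a * b) = a * mrestrict T b"
proof -
  have "mrestrict S (a * b) = mrestrict S (a * mrestrict T b) + mrestrict S (a * mrestrict (- T) b)"
    by (simp flip: mrestrict_add distrib_left add: mrestrict_compl)
  also have "mrestrict S (a * mrestrict T b) = a * mrestrict T b"
    by (rule mrestrict_ident) (use keys_mult[of a "mrestrict T b"] assms in \<open>auto simp: keys_mrestrict\<close>)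
  also have "mrestrict S (a * mrestrict (- T) b) = 0"
    by (rule mrestrict_disjoint) (use keys_mult[of a "mrestrict (- T) b"] assms in \<open>auto simp: keys_mrestrict\<close>)
  finally show ?thesis by simp
qed

section \<open>Weighted degrees of monomials\<close>

definition wdeg :: "(nat \<Rightarrow> int) \<Rightarrow> (nat \<Rightarrow>\<^sub>0 nat) \<Rightarrow> int" where
  "wdeg w m = (\<Sum>v\<in>keys m. int (lookup m v) * w v)"

lemma wdeg_superset: "finite V \<Longrightarrow> keys m \<subseteq> V \<Longrightarrow> wdeg w m = (\<Sum>v\<in>V. int (lookup m v) * w v)"
  unfolding wdeg_def by (rule sum.mono_neutral_left) (auto simp: in_keys_iff)

lemma keys_plus_nat: "keys (m + m') = keys m \<union> keys (m' :: 'a \<Rightarrow>\<^sub>0 nat)"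
  by (auto simp: in_keys_iff lookup_add)

lemma wdeg_add [simp]: "wdeg w (m + m') = wdeg w m + wdeg w m'"
proof -
  let ?V = "keys m \<union> keys m'"
  have "wdeg w (m + m') = (\<Sum>v\<in>?V. int (lookup (m + m') v) * w v)"
    by (rule wdeg_superset) (auto simp: keys_plus_nat)
  also have "\<dots> = (\<Sum>v\<in>?V. int (lookup m v) * w v) + (\<Sum>v\<in>?V. int (lookup m' v) * w v)"
    by (simp add: lookup_add algebra_simps sum.distrib)
  also have "\<dots> = wdeg w m + wdeg w m'"
    by (simp add: wdeg_superset[of ?V, symmetric])
  finally show ?thesis .
qed

lemma wdeg_0 [simp]: "wdeg w 0 = 0"
  by (simp add: wdeg_def)

lemma wdeg_single [simp]: "wdeg w (single v k) = int k * w v"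
  by (simp add: wdeg_def)

section \<open>Evaluation of polynomials\<close>

definition meval :: "('k::comm_ring_1 \<Rightarrow> 'r) \<Rightarrow> (nat \<Rightarrow> 'r) \<Rightarrow> 'k mpol \<Rightarrow> 'r::comm_ring_1" where
  "meval c a p = (\<Sum>m\<in>keys p. c (lookup p m) * (\<Prod>i\<in>keys m. a i ^ lookup m i))"

text \<open>Two coefficient maps are used: the identity, for values at points, and the embedding of
  constants into univariate polynomials, for substitutions that leave one variable free.\<close>

locale coeff_hom =
  fixes c :: "'k::comm_ring_1 \<Rightarrow> 'r::comm_ring_1"
  assumes c_add: "c (x + y) = c x + c y"
    and c_mult: "c (x * y) = c x * c y"
    and c_1: "c 1 = 1"
begin

lemma c_0: "c 0 = 0"
  using c_add[of 0 0] by simp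

lemma meval_add: "meval c a (p + q) = meval c a p + meval c a q"
  unfolding meval_def
  by (rule setsum_keys_plus_distrib) (simp_all add: c_0 c_add algebra_simps)

lemma meval_0 [simp]: "meval c a 0 = 0"
  by (simp add: meval_def)

lemma meval_sum: "meval c a (sum f A) = (\<Sum>i\<in>A. meval c a (f i))"
  by (induction A rule: infinite_finite_induct) (auto simp: meval_add)

lemma meval_uminus: "meval c a (- p) = - meval c a p"
  using meval_add[of a p "- p"] by (simp add: eq_neg_iff_add_eq_0 add.commute)

lemma meval_diff: "meval c a (p - q) = meval c a p - meval c a q"
  using meval_add[of a p "- q"] by (simp add: meval_uminus)

lemma meval_single: "meval c a (single m x) = c x * (\<Prod>i\<in>keys m. a i ^ lookup m i)"
  by (auto simp: meval_def c_0)

lemma monomial_eval_add: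
  "(\<Prod>i\<in>keys (m + m'). a i ^ lookup (m + m') i) =
     (\<Prod>i\<in>keys m. a i ^ lookup m i) * (\<Prod>i\<in>keys m'. (a i :: 'r) ^ lookup m' i)"
proof -
  let ?V = "keys m \<union> keys m'"
  have *: "(\<Prod>i\<in>keys m. a i ^ lookup m i) = (\<Prod>i\<in>?V. (a i :: 'r) ^ lookup m i)"
    "(\<Prod>i\<in>keys m'. a i ^ lookup m' i) = (\<Prod>i\<in>?V. (a i :: 'r) ^ lookup m' i)"
    by (rule prod.mono_neutral_left; auto simp: in_keys_iff)+
  show ?thesis
    unfolding * by (simp add: keys_plus_nat lookup_add power_add prod.distrib)
qed

lemma meval_mult: "meval c a (p * q) = meval c a p * meval c a q"
proof -
  have "meval c a (p * q) =
    (\<Sum>m\<in>keys p. \<Sum>m'\<in>keys q. meval c a (single m (lookup p m)) * meval c a (single m' (lookup q m')))"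
    unfolding mpol_mult_eq
    by (simp add: meval_sum meval_single c_mult monomial_eval_add mult_ac)
  also have "\<dots> = meval c a (\<Sum>m\<in>keys p. single m (lookup p m)) * meval c a (\<Sum>m\<in>keys q. single m (lookup q m))"
    by (simp add: meval_sum sum_product)
  finally show ?thesis by (simp flip: mpol_eq_sum_single)
qed

lemma meval_1 [simp]: "meval c a 1 = 1"
  using meval_single[of a 0 1] by (simp add: c_1)

lemma meval_mvar [simp]: "meval c a (mvar i) = a i"
  by (simp add: mvar_def meval_single c_1)

lemma meval_power: "meval c a (p ^ k) = meval c a p ^ k"
  by (induction k) (auto simp: meval_mult)

end

lemma meval_cong:
  assumes "\<And>i. i \<in> mvars p \<Longrightarrow> a i = b i"
  shows "meval c a p = meval c b p"
  unfolding meval_def using assms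
  by (intro sum.cong arg_cong2[where f = "(*)"] prod.cong refl) (metis UN_I mvars_def)

section \<open>Variables occurring in a polynomial\<close>

lemma mvars_subset_iff: "mvars p \<subseteq> V \<longleftrightarrow> (\<forall>m\<in>keys p. keys m \<subseteq> V)"
  by (auto simp: mvars_def)

lemma mvars_0 [simp]: "mvars 0 = {}"
  by (simp add: mvars_def)

lemma mvars_1 [simp]: "mvars (1 :: 'k::zero_neq_one mpol) = {}"
  by (simp add: mvars_def)

lemma mvars_mvar [simp]: "mvars (mvar i :: 'k::zero_neq_one mpol) = {i}"
  by (simp add: mvars_def mvar_def)

lemma mvars_add: "mvars p \<subseteq> V \<Longrightarrow> mvars q \<subseteq> V \<Longrightarrow> mvars (p + q :: 'k::comm_monoid_add mpol) \<subseteq> V"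
  using keys_add[of p q] unfolding mvars_subset_iff by blast

lemma mvars_uminus [simp]: "mvars (- p) = mvars (p :: 'k::ab_group_add mpol)"
  by (simp add: mvars_def keys_def lookup_uminus)

lemma mvars_diff: "mvars p \<subseteq> V \<Longrightarrow> mvars q \<subseteq> V \<Longrightarrow> mvars (p - q :: 'k::ab_group_add mpol) \<subseteq> V"
  using mvars_add[of p V "- q"] by simp

lemma mvars_mult: "mvars p \<subseteq> V \<Longrightarrow> mvars q \<subseteq> V \<Longrightarrow> mvars (p * q :: 'k::comm_semiring_1 mpol) \<subseteq> V"
  using keys_mult[of p q] unfolding mvars_subset_iff by (fastforce simp: keys_plus_nat)

lemma mvars_power: "mvars p \<subseteq> V \<Longrightarrow> mvars (p ^ k :: 'k::comm_semiring_1 mpol) \<subseteq> V"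
  by (induction k) (simp_all add: mvars_mult)

lemma mvars_sum: "(\<And>i. i \<in> A \<Longrightarrow> mvars (f i) \<subseteq> V) \<Longrightarrow> mvars (sum f A :: 'k::comm_monoid_add mpol) \<subseteq> V"
  by (induction A rule: infinite_finite_induct) (simp_all add: mvars_add)

lemma mvars_mrestrict: "mvars p \<subseteq> V \<Longrightarrow> mvars (mrestrict S p) \<subseteq> V"
  by (auto simp: mvars_subset_iff keys_mrestrict)

lemma mvar_power: "mvar i ^ k = (single (single i k) 1 :: 'k::comm_semiring_1 mpol)"
proof (induction k)
  case 0
  then show ?case by simp
next
  case (Suc k)
  then show ?case by (simp add: mvar_def mult_single flip: single_add)
qed

section \<open>A projective Nullstellensatz\<close>

lemma coeff_hom_id: "coeff_hom (\<lambda>x. x)"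
  by unfold_locales auto

lemma coeff_hom_const: "coeff_hom (\<lambda>x :: 'k::comm_ring_1. [:x:])"
  by unfold_locales (auto simp: mult_pCons_left one_pCons)

interpretation id_hom: coeff_hom "\<lambda>x :: 'k::comm_ring_1. x"
  by (rule coeff_hom_id)

interpretation const_hom: coeff_hom "\<lambda>x :: 'k::comm_ring_1. [:x:]"
  by (rule coeff_hom_const)

abbreviation insertion :: "(nat \<Rightarrow> 'k) \<Rightarrow> 'k mpol \<Rightarrow> 'k::comm_ring_1" where
  "insertion \<equiv> meval (\<lambda>x. x)"

text \<open>A common bound \<open>e\<close> in place of the exact degree lets expansions be added
  coefficientwise, so it suffices to expand monomials.\<close>

lemma mpol_expand_last:
  fixes p :: "'k::comm_ring_1 mpol"
  assumes "mvars p \<subseteq> {..<Suc n}" "\<And>m. m \<in> keys p \<Longrightarrow> lookup m n < e"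
  obtains C where "\<And>l. mvars (C l) \<subseteq> {..<n}" "p = (\<Sum>l<e. C l * mvar n ^ l)"
proof -
  have "\<exists>C. (\<forall>l. mvars (C l :: 'k mpol) \<subseteq> {..<n}) \<and> p = (\<Sum>l<e. C l * mvar n ^ l)"
  proof (induction p rule: mpol_induct)
    case (single m c)
    define k where "k = lookup m n"
    define m' where "m' = m - single n k"
    have m: "m = m' + single n k"
      by (rule poly_mapping_eqI) (auto simp: m'_def k_def lookup_add lookup_minus lookup_single when_def)
    have "lookup m' n = 0"
      by (simp add: m'_def k_def lookup_minus)
    moreover have "keys m \<subseteq> {..<Suc n}"
      using assms(1) single by (auto simp: mvars_subset_iff)
    ultimately have "keys m' \<subseteq> {..<n}"
      unfolding m keys_plus_nat lessThan_Suc by (auto simp del: lookup_not_eq_zero_eq_in_keys simp: in_keys_iff)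
    moreover have "k < e"
      using assms(2) single by (simp add: k_def)
    ultimately show ?case
      by (intro exI[of _ "\<lambda>l. if l = k then single m' c else 0"])
        (auto simp: if_distrib[of "\<lambda>x. x * _"] mvars_def mvar_power mult_single m cong: if_cong)
  next
    case (add p q)
    then obtain C D where "\<forall>l. mvars (C l :: 'k mpol) \<subseteq> {..<n}" "p = (\<Sum>l<e. C l * mvar n ^ l)"
      "\<forall>l. mvars (D l :: 'k mpol) \<subseteq> {..<n}" "q = (\<Sum>l<e. D l * mvar n ^ l)"
      by blast
    then show ?case
      by (intro exI[of _ "\<lambda>l. C l + D l"]) (simp add: mvars_add distrib_right sum.distrib)
  next
    case zero
    show ?case by (intro exI[of _ "\<lambda>_. 0"]) simp
  qed
  then show ?thesis using that by blast
qed

lemma mpol_degree_bound: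
  obtains e where "\<And>m. m \<in> keys (p :: 'k::zero mpol) \<Longrightarrow> lookup m n < e"
proof
  fix m assume "m \<in> keys p"
  then show "lookup m n < Suc (\<Sum>m\<in>keys p. lookup m n)"
    using member_le_sum[of m "keys p" "\<lambda>m. lookup m n"] by (simp add: less_Suc_eq_le)
qed

section \<open>Ideals, radicals and elimination of the last variable\<close>

locale poly_ideal =
  fixes n :: nat and I :: "'k::comm_ring_1 mpol set"
  assumes vars: "p \<in> I \<Longrightarrow> mvars p \<subseteq> {..<n}"
    and zero: "0 \<in> I"
    and add: "p \<in> I \<Longrightarrow> q \<in> I \<Longrightarrow> p + q \<in> I"
    and mult: "mvars a \<subseteq> {..<n} \<Longrightarrow> p \<in> I \<Longrightarrow> a * p \<in> I"
begin

lemma sum: "(\<And>i. i \<in> A \<Longrightarrow> f i \<in> I) \<Longrightarrow> sum f A \<in> I"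
  by (induction A rule: infinite_finite_induct) (auto intro: zero add)

lemma uminus: "p \<in> I \<Longrightarrow> - p \<in> I"
  using mult[of "-1" p] by simp

lemma diff: "p \<in> I \<Longrightarrow> q \<in> I \<Longrightarrow> p - q \<in> I"
  using add[of p "- q"] uminus[of q] by simp

lemma restrict_vars: "m \<le> n \<Longrightarrow> poly_ideal m {p \<in> I. mvars p \<subseteq> {..<m}}"
  by unfold_locales (simp_all add: zero add mvars_add mvars_mult mult order.trans[of "mvars _" "{..<m}" "{..<n}"])

definition radical :: "'k mpol set" where
  "radical = {p. mvars p \<subseteq> {..<n} \<and> (\<exists>k. p ^ k \<in> I)}"

text \<open>For sums, expand \<open>(p + q) ^ (k + l)\<close>: in each term either the exponent of
  \<open>p\<close> is at least \<open>k\<close> or that of \<open>q\<close> is at least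
  \<open>l\<close>.\<close>

lemma poly_ideal_radical: "poly_ideal n radical"
proof
  fix p q assume "p \<in> radical" "q \<in> radical"
  then obtain k l where pq: "mvars p \<subseteq> {..<n}" "mvars q \<subseteq> {..<n}" "p ^ k \<in> I" "q ^ l \<in> I"
    by (auto simp: radical_def)
  have "of_nat (k + l choose i) * p ^ i * q ^ (k + l - i) \<in> I" for i
  proof (cases "i \<ge> k")
    case True
    then have "p ^ i = p ^ (i - k) * p ^ k"
      by (simp flip: power_add)
    then have "of_nat (k + l choose i) * p ^ i * q ^ (k + l - i) =
        (of_nat (k + l choose i) * p ^ (i - k) * q ^ (k + l - i)) * p ^ k"
      by (simp add: mult_ac)
    also have "\<dots> \<in> I"
      using pq by (intro mult mvars_mult mvars_power) (auto simp: mvars_def simp flip: single_of_nat)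
    finally show ?thesis .
  next
    case False
    then have "k + l - i = (k - i) + l" by simp
    then have "of_nat (k + l choose i) * p ^ i * q ^ (k + l - i) =
        (of_nat (k + l choose i) * p ^ i * q ^ (k - i)) * q ^ l"
      by (simp add: mult_ac power_add)
    also have "\<dots> \<in> I"
      using pq by (intro mult mvars_mult mvars_power) (auto simp: mvars_def simp flip: single_of_nat)
    finally show ?thesis .
  qed
  then have "(p + q) ^ (k + l) \<in> I"
    unfolding binomial_ring by (intro sum)
  then show "p + q \<in> radical"
    using pq by (auto simp: radical_def mvars_add)
next
  fix a p :: "'k mpol" assume a: "mvars a \<subseteq> {..<n}" and "p \<in> radical"
  then obtain k where "mvars p \<subseteq> {..<n}" "p ^ k \<in> I"
    by (auto simp: radical_def)
  with a have "mvars (a * p) \<subseteq> {..<n}" "(a * p) ^ k \<in> I"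
    by (simp_all add: mvars_mult power_mult_distrib mult mvars_power)
  then show "a * p \<in> radical"
    by (auto simp: radical_def)
next
  show "0 \<in> radical"
    by (auto simp: radical_def zero intro: exI[of _ 1])
qed (simp add: radical_def)

end

text \<open>An element of the ideal that is monic in x_n makes the quotient ring a finite module
  over the polynomials in x_0, ..., x_{n-1}.\<close>

locale poly_ideal_Suc = poly_ideal "Suc n" I for n and I :: "'k::comm_ring_1 mpol set" +
  fixes e :: nat and c :: "nat \<Rightarrow> 'k mpol"
  assumes vars_c: "mvars (c l) \<subseteq> {..<n}"
    and monic: "mvar n ^ e + (\<Sum>l<e. c l * mvar n ^ l) \<in> I"
begin

text \<open>The preimage of the submodule of the quotient by \<open>I\<close> that 1, x_n, ...,
  x_n^(j-1) generate over the polynomials in x_0, ..., x_{n-1}. In particular \<open>M 0\<close> is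
  \<open>I\<close> itself.\<close>

definition M :: "nat \<Rightarrow> 'k mpol set" where
  "M j = {q + (\<Sum>l<j. C l * mvar n ^ l) | q C. q \<in> I \<and> (\<forall>l. mvars (C l) \<subseteq> {..<n})}"

lemma vars_Suc: "mvars a \<subseteq> {..<n} \<Longrightarrow> mvars a \<subseteq> {..<Suc n}"
  by (auto simp: subset_iff)

lemma M_I: "p \<in> I \<Longrightarrow> p \<in> M j"
  unfolding M_def by (auto intro!: exI[of _ p] exI[of _ "\<lambda>_. 0"])

lemma M_pow: "l < j \<Longrightarrow> mvar n ^ l \<in> M j"
  unfolding M_def
  by (auto intro!: exI[of _ 0] exI[of _ "\<lambda>i. if i = l then 1 else 0"] zero simp: if_distrib[of "\<lambda>x. x * _"] mvars_def split: if_splits cong: if_cong)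

lemma M_add: "p \<in> M j \<Longrightarrow> q \<in> M j \<Longrightarrow> p + q \<in> M j"
proof -
  assume "p \<in> M j" "q \<in> M j"
  then obtain p' q' C D where "p' \<in> I" "q' \<in> I" "\<forall>l. mvars (C l) \<subseteq> {..<n}" "\<forall>l. mvars (D l) \<subseteq> {..<n}"
    and "p = p' + (\<Sum>l<j. C l * mvar n ^ l)" "q = q' + (\<Sum>l<j. D l * mvar n ^ l)"
    unfolding M_def by blast
  then show ?thesis
    unfolding M_def
    by (intro CollectI exI[of _ "p' + q'"] exI[of _ "\<lambda>l. C l + D l"])
      (simp add: add mvars_add distrib_right sum.distrib)
qed

lemma M_mult: "mvars a \<subseteq> {..<n} \<Longrightarrow> p \<in> M j \<Longrightarrow> a * p \<in> M j"
proof -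
  assume a: "mvars a \<subseteq> {..<n}" and "p \<in> M j"
  then obtain p' C where "p' \<in> I" "\<forall>l. mvars (C l) \<subseteq> {..<n}"
    and "p = p' + (\<Sum>l<j. C l * mvar n ^ l)"
    unfolding M_def by blast
  then show ?thesis
    using a vars_Suc[OF a] unfolding M_def
    by (intro CollectI exI[of _ "a * p'"] exI[of _ "\<lambda>l. a * C l"])
      (simp add: mult mvars_mult distrib_left sum_distrib_left mult.assoc)
qed

lemma M_sum: "(\<And>i. i \<in> A \<Longrightarrow> f i \<in> M j) \<Longrightarrow> sum f A \<in> M j"
  by (induction A rule: infinite_finite_induct) (auto intro: M_I zero M_add)

lemma M_uminus: "p \<in> M j \<Longrightarrow> - p \<in> M j"
  using M_mult[of "-1" p] by simp

lemma M_diff: "p \<in> M j \<Longrightarrow> q \<in> M j \<Longrightarrow> p - q \<in> M j"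
  using M_add[of p j "- q"] M_uminus[of q] by simp

text \<open>For an exponent \<open>i\<close> at least \<open>e\<close>, the monic element times
  x_n^(i-e) rewrites x_n^i in terms of lower powers.\<close>

lemma power_in_M: "mvar n ^ i \<in> M e"
proof (induction i rule: less_induct)
  case (less i)
  show ?case
  proof (cases "i < e")
    case True
    then show ?thesis by (rule M_pow)
  next
    case False
    then have i: "i = (i - e) + e" by simp
    have "mvar n ^ i = mvar n ^ (i - e) * (mvar n ^ e + (\<Sum>l<e. c l * mvar n ^ l))
        - (\<Sum>l<e. c l * mvar n ^ (i - e + l))"
      by (subst i) (simp add: power_add distrib_left sum_distrib_left mult_ac)
    also have "\<dots> \<in> M e"
    proof (rule M_diff)
      show "mvar n ^ (i - e) * (mvar n ^ e + (\<Sum>l<e. c l * mvar n ^ l)) \<in> M e"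
        by (intro M_I mult monic mvars_power) simp
      show "(\<Sum>l<e. c l * mvar n ^ (i - e + l)) \<in> M e"
        using less False by (intro M_sum M_mult vars_c) auto
    qed
    finally show ?thesis .
  qed
qed

text \<open>The \<open>x\<^sub>n\<^sup>i\<close> with \<open>i < e\<close> generate \<open>K[x\<^sub>0, \<dots>, x\<^sub>n] / I\<close>; they are eliminated one at a time.\<close>

lemma nakayama:
  assumes f: "f \<in> I" "1 - f = (\<Sum>i<k. D i * mvar n ^ i)"
    and D: "\<And>i. mvars (D i) \<subseteq> {..<n}" "\<And>i. i < k \<Longrightarrow> insertion a (D i) = 0"
  obtains s where "s \<in> I" "mvars s \<subseteq> {..<n}" "insertion a s = 1"
proof -
  \<comment> \<open>Invariant: an element \<open>s\<close> with value 1 at \<open>a\<close>, which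
    acts as a unit near \<open>a\<close>, multiplies every power of x_n into \<open>M j\<close>. It
    starts with s = 1 at j = e and descends to j = 0.\<close>
  have "\<exists>s. mvars s \<subseteq> {..<n} \<and> insertion a s = 1 \<and> (\<forall>i. s * mvar n ^ i \<in> M j)" if "j \<le> e" for j
    using that
  proof (induction j rule: inc_induct)
    case base
    show ?case by (intro exI[of _ 1]) (simp add: power_in_M)
  next
    case (step j)
    then obtain s where s: "mvars s \<subseteq> {..<n}" "insertion a s = 1" "\<And>i. s * mvar n ^ i \<in> M (Suc j)"
      by blast
    have "\<forall>i. \<exists>q C. q \<in> I \<and> (\<forall>l. mvars (C l) \<subseteq> {..<n}) \<and>
        s * mvar n ^ i = q + (\<Sum>l<Suc j. C l * mvar n ^ l)"
    proof
      fix i show "\<exists>q C. q \<in> I \<and> (\<forall>l. mvars (C l) \<subseteq> {..<n}) \<and>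
        s * mvar n ^ i = q + (\<Sum>l<Suc j. C l * mvar n ^ l)"
        using s(3)[of i] unfolding M_def by blast
    qed
    then obtain q C where qC: "\<And>i. q i \<in> I" "\<And>i l. mvars (C i l) \<subseteq> {..<n}"
      "\<And>i. s * mvar n ^ i = q i + (\<Sum>l<Suc j. C i l * mvar n ^ l)"
      unfolding choice_iff by blast
    \<comment> \<open>Modulo \<open>I\<close>, \<open>1 - f\<close> is 1, so s x_n^j is congruent to
      the sum of the \<open>D i\<close> times s x_n^(i+j). Expanding these, \<open>b\<close>
      collects the coefficient of x_n^j. It vanishes at \<open>a\<close>, and moving it to the left
      puts (s - b) x_n^j into \<open>M j\<close>.\<close>
    define b where "b = (\<Sum>i<k. D i * C (i + j) j)"
    have b: "mvars b \<subseteq> {..<n}" "insertion a b = 0"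
      unfolding b_def by (intro mvars_sum mvars_mult D qC) (simp add: id_hom.meval_sum id_hom.meval_mult D)
    have "s * mvar n ^ j = s * mvar n ^ j * f + s * mvar n ^ j * (1 - f)"
      by (simp add: right_diff_distrib)
    also have "s * mvar n ^ j * (1 - f) = (\<Sum>i<k. D i * (s * mvar n ^ (i + j)))"
      unfolding f by (simp add: sum_distrib_left power_add mult_ac)
    also have "\<dots> = (\<Sum>i<k. D i * (q (i + j) + (\<Sum>l<j. C (i + j) l * mvar n ^ l))) + b * mvar n ^ j"
      unfolding qC(3) b_def by (simp add: sum_distrib_right distrib_left sum.distrib mult.assoc)
    finally have "(s - b) * mvar n ^ j = s * mvar n ^ j * f +
        (\<Sum>i<k. D i * (q (i + j) + (\<Sum>l<j. C (i + j) l * mvar n ^ l)))"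
      by (simp add: left_diff_distrib diff_eq_eq add.assoc)
    also have "\<dots> \<in> M j"
    proof (rule M_add)
      show "s * mvar n ^ j * f \<in> M j"
        by (intro M_I mult f mvars_mult mvars_power vars_Suc[OF s(1)]) simp
      show "(\<Sum>i<k. D i * (q (i + j) + (\<Sum>l<j. C (i + j) l * mvar n ^ l))) \<in> M j"
        by (intro M_sum M_mult[OF D(1)] M_mult[OF qC(2)] M_add M_I[OF qC(1)] M_pow) simp
    qed
    finally have sb: "(s - b) * mvar n ^ j \<in> M j" .
    \<comment> \<open>The factor \<open>s\<close> brings x_n^i into \<open>M (Suc j)\<close>; the
      factor \<open>s - b\<close> then removes the remaining multiple of x_n^j.\<close>
    have "(s - b) * s * mvar n ^ i \<in> M j" for i
    proof -
      have "(s - b) * s * mvar n ^ i = (s - b) * (q i + (\<Sum>l<j. C i l * mvar n ^ l))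
          + C i j * ((s - b) * mvar n ^ j)"
        unfolding mult.assoc[of "s - b" s] qC(3)
        by (simp only: sum.lessThan_Suc distrib_left mult.left_commute[of "C i j"] add.assoc)
      also have "\<dots> \<in> M j"
        by (intro M_add M_mult[OF mvars_diff[OF s(1) b(1)] M_add] M_mult[OF _ sb] M_sum M_mult[OF qC(2)] M_pow M_I[OF qC(1)] qC(2)) simp
      finally show ?thesis .
    qed
    then show ?case
      using s b by (intro exI[of _ "(s - b) * s"])
        (simp add: id_hom.meval_mult id_hom.meval_diff mvars_mult mvars_diff)
  qed
  from this[of 0] obtain s where s: "mvars s \<subseteq> {..<n}" "insertion a s = 1" "\<And>i. s * mvar n ^ i \<in> M 0"
    by auto
  \<comment> \<open>The power x_n^0 = 1 lies in the quotient, so \<open>s\<close> itself is in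
    \<open>M 0\<close>.\<close>
  have "s \<in> I" using s(3)[of 0] by (auto simp: M_def)
  then show ?thesis using s that by blast
qed

end

section \<open>Extending zeros of the elimination ideal\<close>

lemma poly_meval_const:
  "poly (meval (\<lambda>x. [:x:]) v p) b = insertion (\<lambda>i. poly (v i) b) (p :: 'k::comm_ring_1 mpol)"
  by (simp add: meval_def poly_sum poly_prod poly_power)

lemma const_poly_sum: "[:sum f A:] = (\<Sum>i\<in>A. [:f i:])"
  by (rule poly_eqI) (simp add: coeff_sum coeff_pCons split: nat.split)

lemma const_poly_prod: "[:prod f A:] = (\<Prod>i\<in>A. [:f i :: 'k::comm_ring_1:])"
  by (induction A rule: infinite_finite_induct) (simp_all add: one_pCons, metis mult_pCons_left mult_zero_right pCons_0_0 smult_pCons add_0_right smult_0_right)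

lemma meval_const_const:
  fixes p :: "'k::comm_ring_1 mpol"
  assumes "\<And>i. i \<in> mvars p \<Longrightarrow> v i = [:a i:]"
  shows "meval (\<lambda>x. [:x:]) v p = [:insertion a p:]"
proof -
  have "meval (\<lambda>x. [:x:]) v p = meval (\<lambda>x. [:x:]) (\<lambda>i. [:a i:]) p"
    using assms by (rule meval_cong)
  also have "\<dots> = [:insertion a p:]"
    by (simp add: meval_def const_poly_sum const_poly_prod poly_const_pow mult.commute flip: const_poly_prod)
  finally show ?thesis .
qed

lemma mvars_mconst [simp]: "mvars (mconst c) = {}"
  by (simp add: mvars_def mconst_def)

text \<open>A nonzero element of least degree divides every element of \<open>J\<close> by division
  with remainder. It is not constant because 1 is not in \<open>J\<close>, so it has a root.\<close>

lemma poly_ideal_common_root: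
  fixes J :: "'k::alg_closed_field poly set"
  assumes "\<And>p q. p \<in> J \<Longrightarrow> q \<in> J \<Longrightarrow> p + q \<in> J" "\<And>p q. q \<in> J \<Longrightarrow> p * q \<in> J"
    and "1 \<notin> J" "g \<in> J" "g \<noteq> 0"
  obtains b where "\<And>p. p \<in> J \<Longrightarrow> poly p b = 0"
proof -
  obtain h where h: "h \<in> J" "h \<noteq> 0" and min: "\<And>p. p \<in> J \<Longrightarrow> p \<noteq> 0 \<Longrightarrow> degree h \<le> degree p"
    using ex_has_least_nat[of "\<lambda>p. p \<in> J \<and> p \<noteq> 0" g degree] assms(4,5) by blast
  have "degree h > 0"
  proof (rule ccontr)
    assume "\<not> degree h > 0"
    then obtain c where c: "h = [:c:]"
      by (metis degree_eq_zeroE gr0I)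
    then have "[:inverse c:] * h = 1"
      using h(2) by (simp add: one_pCons)
    then show False
      using assms(2)[OF h(1), of "[:inverse c:]"] assms(3) by simp
  qed
  then obtain b where b: "poly h b = 0"
    using alg_closed_imp_poly_has_root by blast
  have "poly p b = 0" if p: "p \<in> J" for p
  proof -
    have "p + (- (p div h)) * h \<in> J"
      using p h by (intro assms)
    then have "p mod h \<in> J"
      by (simp add: minus_div_mult_eq_mod)
    then have "p mod h = 0"
      using min[of "p mod h"] degree_mod_less'[of h p] h(2) by fastforce
    then show ?thesis
      using b by (metis mod_0_imp_dvd dvdE mult_zero_left poly_mult)
  qed
  then show ?thesis by (rule that)
qed

text \<open>Substituting \<open>a\<close> for x_0, ..., x_{n-1} turns \<open>I\<close> into a
  univariate ideal \<open>J\<close>. Nakayama shows that \<open>J\<close> is proper and the monic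
  element that it is nonzero, so \<open>J\<close> has a common root \<open>b\<close>.\<close>

lemma poly_ideal_extend_zero:
  fixes I :: "'k::alg_closed_field mpol set"
  assumes "poly_ideal_Suc n I e c"
    and a: "\<And>p. p \<in> I \<Longrightarrow> mvars p \<subseteq> {..<n} \<Longrightarrow> insertion a p = 0"
  obtains b where "\<And>p. p \<in> I \<Longrightarrow> insertion (a(n := b)) p = 0"
proof -
  interpret poly_ideal_Suc n I e c by fact
  define U where "U = meval (\<lambda>x :: 'k. [:x:]) ((\<lambda>i. [:a i:])(n := [:0, 1:]))"
  have U_const: "U p = [:insertion a p:]" if "mvars p \<subseteq> {..<n}" for p
    unfolding U_def by (rule meval_const_const) (use that in auto)
  have U_term: "U (p * mvar n ^ l) = monom (insertion a p) l" if "mvars p \<subseteq> {..<n}" for p l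
  proof -
    have "U (p * mvar n ^ l) = U p * U (mvar n) ^ l"
      unfolding U_def by (simp only: const_hom.meval_mult const_hom.meval_power)
    also have "U (mvar n) = [:0, 1:]"
      by (simp add: U_def)
    finally show ?thesis
      using that by (simp add: U_const monom_altdef)
  qed
  have U_sum: "U (\<Sum>l<k. C l * mvar n ^ l) = (\<Sum>l<k. monom (insertion a (C l)) l)"
    if "\<And>l. mvars (C l) \<subseteq> {..<n}" for C k
    using that by (simp add: U_def const_hom.meval_sum flip: U_term)
  define J where "J = U ` I"
  have J_add: "p + q \<in> J" if pq: "p \<in> J" "q \<in> J" for p q
  proof -
    obtain p' q' where "p' \<in> I" "q' \<in> I" "p = U p'" "q = U q'"
      using pq by (auto simp: J_def)
    then have "p + q = U (p' + q')" "p' + q' \<in> I"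
      by (simp_all add: U_def const_hom.meval_add add)
    then show ?thesis by (auto simp: J_def)
  qed
  have J_mult: "p * q \<in> J" if q: "q \<in> J" for p q
  proof -
    obtain q' where q': "q' \<in> I" "q = U q'"
      using q by (auto simp: J_def)
    \<comment> \<open>A preimage of \<open>p\<close> under the substitution, obtained by writing x_n
      for the univariate indeterminate; thus the image of the ideal is again an ideal.\<close>
    define p' where "p' = (\<Sum>l<Suc (degree p). mconst (coeff p l) * mvar n ^ l)"
    have "insertion a (mconst x) = x" for x
      by (simp add: mconst_def id_hom.meval_single)
    then have "U p' = p"
      unfolding p'_def by (subst U_sum) (simp_all only: mvars_mconst lessThan_Suc_atMost poly_as_sum_of_monoms empty_subsetI)
    then have "p * q = U (p' * q')"
      by (simp add: q' U_def const_hom.meval_mult)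
    moreover have "p' * q' \<in> I"
      unfolding p'_def by (intro mult q' mvars_sum mvars_mult mvars_power) auto
    ultimately show ?thesis by (auto simp: J_def)
  qed
  have "1 \<notin> J"
  proof
    assume "1 \<in> J"
    then obtain f where f: "f \<in> I" "U f = 1"
      by (auto simp: J_def)
    obtain k where "\<And>m. m \<in> keys (1 - f) \<Longrightarrow> lookup m n < k"
      using mpol_degree_bound[of "1 - f" n] by blast
    moreover have "mvars (1 - f) \<subseteq> {..<Suc n}"
      using vars[OF f(1)] by (intro mvars_diff) auto
    ultimately obtain D where D: "\<And>l. mvars (D l) \<subseteq> {..<n}" "1 - f = (\<Sum>l<k. D l * mvar n ^ l)"
      using mpol_expand_last[of "1 - f" n k] by blast
    \<comment> \<open>The x_n-coefficients of \<open>1 - f\<close> therefore vanish at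
      \<open>a\<close>, as \<open>nakayama\<close> requires. It yields an element of the elimination
      ideal with value 1 at \<open>a\<close>, although \<open>a\<close> is a zero of that
      ideal.\<close>
    have "0 = U (1 - f)"
      using f by (simp add: U_def const_hom.meval_diff)
    also have "\<dots> = (\<Sum>l<k. monom (insertion a (D l)) l)"
      unfolding D(2) using D(1) by (rule U_sum)
    finally have *: "0 = (\<Sum>l<k. monom (insertion a (D l)) l)" .
    have "insertion a (D l) = 0" if "l < k" for l
      using arg_cong[OF *, of "\<lambda>p. coeff p l"] that by (simp add: coeff_sum)
    then obtain s where "s \<in> I" "mvars s \<subseteq> {..<n}" "insertion a s = 1"
      using nakayama[OF f(1) D(2) D(1)] by metis
    then show False using a[of s] by simp
  qed
  \<comment> \<open>The leading coefficient 1 survives the substitution, so \<open>J\<close> has a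
    nonzero element.\<close>
  moreover define g where "g = mvar n ^ e + (\<Sum>l<e. c l * mvar n ^ l)"
  have "U g = monom 1 e + (\<Sum>l<e. monom (insertion a (c l)) l)"
    using U_term[of 1 e] U_sum[of c e, OF vars_c] by (simp add: g_def U_def const_hom.meval_add)
  then have "coeff (U g) e = 1"
    by (simp add: coeff_sum)
  then have "U g \<noteq> 0" by auto
  moreover have "U g \<in> J"
    using monic by (simp add: J_def g_def)
  ultimately obtain b where b: "\<And>p. p \<in> J \<Longrightarrow> poly p b = 0"
    using poly_ideal_common_root[of J "U g"] J_add J_mult by metis
  show ?thesis
  proof
    fix p assume "p \<in> I"
    then have "poly (U p) b = 0"
      using b by (auto simp: J_def)
    then show "insertion (a(n := b)) p = 0"
      by (simp add: U_def poly_meval_const fun_upd_def if_distrib[of "\<lambda>q. poly q b"] cong: if_cong)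
  qed
qed

lemma lookup_mconst_mult: "lookup (mconst c * p) m = c * lookup p (m :: nat \<Rightarrow>\<^sub>0 nat)"
  unfolding mconst_def mult_map_scale_conv_mult[symmetric] by transfer (simp add: when_def)

definition homogeneous_component :: "nat \<Rightarrow> 'k::zero mpol \<Rightarrow> 'k mpol" where
  "homogeneous_component e = mrestrict {m. wdeg (\<lambda>_. 1) m = int e}"

text \<open>The elimination ideal inherits the hypotheses, since its zeros extend to zeros of
  \<open>I\<close>. By induction the radical contains x_0, ..., x_{n-1}; a homogeneous element of
  \<open>I\<close> monic in x_n then puts x_n into the radical too.\<close>

theorem projective_nullstellensatz:
  fixes I :: "'k::alg_closed_field mpol set"
  assumes "poly_ideal n I"
    and "\<And>p e. p \<in> I \<Longrightarrow> homogeneous_component e p \<in> I"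
    and "\<And>a i. (\<And>p. p \<in> I \<Longrightarrow> insertion a p = 0) \<Longrightarrow> i < n \<Longrightarrow> a i = 0"
    and "i < n"
  shows "\<exists>k. mvar i ^ k \<in> I"
  using assms
proof (induction n arbitrary: I i)
  case 0
  then show ?case by simp
next
  case (Suc n)
  interpret poly_ideal "Suc n" I by fact
  \<comment> \<open>At the point (0, ..., 0, 1) a monomial is nonzero only if it is a pure power of
    x_n, so some \<open>p\<close> in \<open>I\<close> contains such a power.\<close>
  define a :: "nat \<Rightarrow> 'k" where "a = (\<lambda>i. if i = n then 1 else 0)"
  obtain p where p: "p \<in> I" "insertion a p \<noteq> 0"
    using Suc.prems(3)[of a n] by (auto simp: a_def)
  then obtain m where m: "m \<in> keys p" "(\<Prod>i\<in>keys m. a i ^ lookup m i) \<noteq> 0"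
    unfolding meval_def by (metis (no_types, lifting) mult_zero_right sum.neutral)
  define e where "e = lookup m n"
  have "i = n" if "i \<in> keys m" for i
    using m(2) that by (auto simp: a_def in_keys_iff split: if_splits)
  then have m_eq: "m = single n e"
    by (intro poly_mapping_eqI) (metis e_def in_keys_iff lookup_single_eq lookup_single_not_eq)
  \<comment> \<open>The component of \<open>p\<close> of degree \<open>e\<close>, scaled so that
    x_n^e has coefficient 1.\<close>
  define g where "g = mconst (inverse (lookup p m)) * homogeneous_component e p"
  have "g \<in> I"
    unfolding g_def using p by (intro mult Suc.prems) auto
  have g_deg: "wdeg (\<lambda>_. 1) m' = int e" if "m' \<in> keys g" for m'
    using that keys_mult[of "mconst (inverse (lookup p m))" "homogeneous_component e p"]
    by (auto simp: g_def homogeneous_component_def keys_mrestrict mconst_def split: if_splits)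
  have "lookup g m = 1"
  proof -
    have "lookup g m = inverse (lookup p m) * lookup (homogeneous_component e p) m"
      unfolding g_def by (rule lookup_mconst_mult)
    then show ?thesis
      using m(1) by (simp add: homogeneous_component_def lookup_mrestrict m_eq in_keys_iff)
  qed
  define t where "t = g - mvar n ^ e"
  have lookup_t: "lookup t m' = (if m' = m then 0 else lookup g m')" for m'
    using \<open>lookup g m = 1\<close> by (auto simp: t_def mvar_power m_eq lookup_minus lookup_single when_def)
  have t_vars: "mvars t \<subseteq> {..<Suc n}"
    unfolding t_def using vars[OF \<open>g \<in> I\<close>] by (intro mvars_diff mvars_power) auto
  \<comment> \<open>A monomial of degree \<open>e\<close> other than x_n^e involves an earlier
    variable and hence has a smaller exponent at x_n. The first fact later puts \<open>t\<close>
    into the radical, the second makes \<open>g\<close> monic in x_n.\<close>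
  have t_keys: "\<exists>i<n. i \<in> keys m'" "lookup m' n < e" if "m' \<in> keys t" for m'
  proof -
    from that have m': "m' \<in> keys g" "m' \<noteq> m"
      by (auto simp: in_keys_iff lookup_t split: if_splits)
    have "keys m' \<subseteq> {..<Suc n}"
      using t_vars that by (auto simp: mvars_subset_iff)
    then have "wdeg (\<lambda>_. 1) m' = (\<Sum>v<Suc n. int (lookup m' v))"
      by (subst wdeg_superset[of "{..<Suc n}"]) auto
    then have e: "e = (\<Sum>v<n. lookup m' v) + lookup m' n"
      using g_deg[OF m'(1)] by (simp flip: of_nat_sum of_nat_add)
    show "\<exists>i<n. i \<in> keys m'"
    proof (rule ccontr)
      assume *: "\<not> ?thesis"
      then have **: "lookup m' v = 0" if "v \<noteq> n" for v
        using \<open>keys m' \<subseteq> {..<Suc n}\<close> that by (metis in_keys_iff lessThan_iff less_SucE subsetD)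
      then have "lookup m' n = e" using e by simp
      then have "m' = m"
        unfolding m_eq by (intro poly_mapping_eqI) (use ** in \<open>auto simp: lookup_single when_def\<close>)
      with m' show False by simp
    qed
    then obtain i where "i < n" "lookup m' i > 0"
      by (auto simp: in_keys_iff)
    then have "(\<Sum>v<n. lookup m' v) > 0"
      by (intro sum_pos2[of _ i]) auto
    then show "lookup m' n < e" using e by simp
  qed
  obtain c where c: "\<And>l. mvars (c l) \<subseteq> {..<n}" "t = (\<Sum>l<e. c l * mvar n ^ l)"
    using mpol_expand_last[OF t_vars t_keys(2)] by blast
  have ext: "poly_ideal_Suc n I e c"
  proof
    have "mvar n ^ e + (\<Sum>l<e. c l * mvar n ^ l) = g"
      by (simp flip: c(2) add: t_def)
    then show "mvar n ^ e + (\<Sum>l<e. c l * mvar n ^ l) \<in> I"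
      using \<open>g \<in> I\<close> by simp
  qed (rule c)
  define I' where "I' = {p \<in> I. mvars p \<subseteq> {..<n}}"
  have IH: "\<exists>k. mvar i ^ k \<in> I'" if "i < n" for i
  proof (rule Suc.IH[OF _ _ _ that])
    show "poly_ideal n I'"
      unfolding I'_def by (rule restrict_vars) simp
    show "homogeneous_component e p \<in> I'" if "p \<in> I'" for p e
      using that Suc.prems(2)[of p e] by (simp add: I'_def homogeneous_component_def mvars_mrestrict)
  next
    fix a i assume "\<And>p. p \<in> I' \<Longrightarrow> insertion a p = 0" and i: "i < n"
    then obtain b where "\<And>p. p \<in> I \<Longrightarrow> insertion (a(n := b)) p = 0"
      using poly_ideal_extend_zero[OF ext, of a] unfolding I'_def by auto
    from Suc.prems(3)[OF this, of i] show "a i = 0"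
      using i by simp
  qed
  interpret R: poly_ideal "Suc n" radical
    by (rule poly_ideal_radical)
  have IR: "p \<in> I \<Longrightarrow> p \<in> radical" for p
    using vars[of p] by (auto simp: radical_def intro: exI[of _ 1])
  have xR: "mvar i \<in> radical" if "i < n" for i
    using IH[OF that] that by (auto simp: radical_def I'_def)
  \<comment> \<open>Each monomial of \<open>t\<close> is divisible by some x_i with i < n, which
    lies in the radical by the induction hypothesis.\<close>
  have "single m' x \<in> radical" if m': "m' \<in> keys t" for m' x
  proof -
    obtain i where i: "i < n" "i \<in> keys m'"
      using t_keys(1)[OF m'] by auto
    define m'' where "m'' = m' - single i 1"
    have m'_eq: "m' = m'' + single i 1"
      using i by (intro poly_mapping_eqI)
        (auto simp: m''_def lookup_add lookup_minus lookup_single when_def in_keys_iff)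
    have "keys m' \<subseteq> {..<Suc n}"
      using t_vars m' by (simp add: mvars_subset_iff)
    then have "keys m'' \<subseteq> {..<Suc n}"
      by (simp add: m'_eq keys_plus_nat)
    then have "single m'' x * mvar i \<in> radical"
      by (intro R.mult xR i) (auto simp: mvars_def)
    then show ?thesis
      by (simp add: mvar_def mult_single m'_eq)
  qed
  then have "t \<in> radical"
    by (subst mpol_eq_sum_single[of t]) (rule R.sum)
  then have "g - t \<in> radical"
    using IR[OF \<open>g \<in> I\<close>] by (rule R.diff[rotated])
  then have "mvar n ^ e \<in> radical"
    by (simp add: t_def)
  then obtain k where "(mvar n ^ e) ^ k \<in> I"
    by (auto simp: radical_def)
  then have "mvar n ^ (e * k) \<in> I"
    by (simp add: power_mult)
  then show ?case
    using IH[of i] Suc.prems(4) by (cases "i = n") (auto simp: I'_def)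
qed

section \<open>Descent from the algebraic closure to the base field\<close>

lemma lookup_map_poly_mapping: "f 0 = 0 \<Longrightarrow> lookup (Poly_Mapping.map f p) m = f (lookup p m)"
  by transfer (simp add: when_def)

lemma keys_map_to_ac: "keys (Poly_Mapping.map to_ac p) = keys p"
  by (auto simp: in_keys_iff lookup_map_poly_mapping)

lemma insertion_map_to_ac: "insertion a (Poly_Mapping.map to_ac p) = meval_ac a p"
  by (simp add: meval_def meval_ac_def keys_map_to_ac lookup_map_poly_mapping)

text \<open>The embedding of the field into its closure is linear and injective, so it has a linear
  left inverse. This is not a ring homomorphism in general.\<close>

lemma alg_closure_retraction:
  obtains \<phi> :: "'k::field alg_closure \<Rightarrow> 'k"
  where "\<And>x y. \<phi> (x + y) = \<phi> x + \<phi> y" "\<And>c x. \<phi> (to_ac c * x) = c * \<phi> x" "\<phi> 1 = 1"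
proof -
  interpret vs: vector_space_pair "(*) :: 'k \<Rightarrow> 'k \<Rightarrow> 'k" "\<lambda>c x :: 'k alg_closure. to_ac c * x"
    by unfold_locales (auto simp: algebra_simps)
  have "Vector_Spaces.linear ((*) :: 'k \<Rightarrow> 'k \<Rightarrow> 'k) (\<lambda>c x. to_ac c * x) to_ac"
    by unfold_locales auto
  from vs.linear_injective_left_inverse[OF this inj_to_ac]
  obtain \<phi> where "Vector_Spaces.linear (\<lambda>c x. to_ac c * x) ((*) :: 'k \<Rightarrow> 'k \<Rightarrow> 'k) \<phi>" "\<phi> \<circ> to_ac = id"
    by blast
  then interpret \<phi>: Vector_Spaces.linear "\<lambda>c x. to_ac c * x" "(*) :: 'k \<Rightarrow> 'k \<Rightarrow> 'k" \<phi>
    by simp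
  show ?thesis
  proof
    show "\<phi> 1 = 1"
      using \<open>\<phi> \<circ> to_ac = id\<close> by (metis comp_apply id_apply to_ac_1)
  qed (simp_all add: \<phi>.add \<phi>.scale)
qed

text \<open>Linearity over the base field suffices because one factor has its coefficients there;
  both sides are additive, which leaves the case of monomials.\<close>

lemma map_retraction_mult:
  fixes \<phi> :: "'k::field alg_closure \<Rightarrow> 'k"
  assumes add: "\<And>x y. \<phi> (x + y) = \<phi> x + \<phi> y" and scale: "\<And>c x. \<phi> (to_ac c * x) = c * \<phi> x"
  shows "Poly_Mapping.map \<phi> (p * Poly_Mapping.map to_ac q) = Poly_Mapping.map \<phi> p * (q :: 'k mpol)"
proof -
  have \<phi>_0: "\<phi> 0 = 0"
    using scale[of 0 0] by simp
  have map_add: "Poly_Mapping.map \<phi> (p + q) = Poly_Mapping.map \<phi> p + Poly_Mapping.map \<phi> q"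
    for p q :: "'k alg_closure mpol"
    by (rule poly_mapping_eqI) (simp add: lookup_map_poly_mapping \<phi>_0 lookup_add add)
  have map_add': "Poly_Mapping.map to_ac (p + q) = Poly_Mapping.map to_ac p + Poly_Mapping.map to_ac q"
    for p q :: "'k mpol"
    by (rule poly_mapping_eqI) (simp add: lookup_map_poly_mapping lookup_add)
  have map_0: "Poly_Mapping.map to_ac (0 :: 'k mpol) = 0" "Poly_Mapping.map \<phi> (0 :: 'k alg_closure mpol) = 0"
    by (simp_all add: map_eq_zero_iff)
  have *: "Poly_Mapping.map \<phi> (single m x * Poly_Mapping.map to_ac (single m' c)) =
      Poly_Mapping.map \<phi> (single m x) * single m' c" for m m' x c
    using scale[of c x] by (simp add: mult_single \<phi>_0 mult.commute)
  show ?thesis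
  proof (induction p rule: mpol_induct)
    case (single m x)
    show ?case
    proof (induction q rule: mpol_induct)
      case (single m' c)
      show ?case by (rule *)
    next
      case (add p q)
      then show ?case by (simp only: map_add map_add' distrib_left)
    qed (simp add: map_0)
  qed (simp_all add: distrib_right map_add map_0)
qed

text \<open>Over the closure the identities come from \<open>projective_nullstellensatz\<close>.
  They are linear in the unknown multipliers, so the retraction carries them to the base field,
  where the homogeneous parts of the right degree are selected.\<close>

lemma nullstellensatz_certificate_exists:
  fixes f :: "nat \<Rightarrow> 'k::field mpol"
  assumes vars: "\<And>j. j < r \<Longrightarrow> mvars (f j) \<subseteq> {..<n}"
    and hom: "\<And>j m. j < r \<Longrightarrow> m \<in> keys (f j) \<Longrightarrow> wdeg (\<lambda>_. 1) m = int (d j)"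
    and "no_common_zero n r f"
  obtains N h where "1 \<le> N"
    "\<And>l j. l < n \<Longrightarrow> j < r \<Longrightarrow> mvars (h l j :: 'k mpol) \<subseteq> {..<n}"
    "\<And>l j m. l < n \<Longrightarrow> j < r \<Longrightarrow> m \<in> keys (h l j) \<Longrightarrow> wdeg (\<lambda>_. 1) m + int (d j) = int N"
    "\<And>l. l < n \<Longrightarrow> mvar l ^ N = (\<Sum>j<r. h l j * f j)"
proof -
  define fL where "fL j = Poly_Mapping.map to_ac (f j)" for j
  have vars_L: "mvars (fL j) \<subseteq> {..<n}" if "j < r" for j
    using vars[OF that] by (simp add: fL_def mvars_def keys_map_to_ac)
  define I where "I = {\<Sum>j<r. H j * fL j | H. \<forall>j. mvars (H j) \<subseteq> {..<n}}"
  have fL_I: "fL j \<in> I" if "j < r" for j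
  proof -
    have "fL j = (\<Sum>i<r. (if i = j then 1 else 0) * fL i)"
      using that by (simp add: if_distrib[of "\<lambda>x. x * _"] cong: if_cong)
    then show ?thesis unfolding I_def
      by (intro CollectI exI[of _ "\<lambda>i. if i = j then 1 else 0"]) (simp add: mvars_def)
  qed
  have I: "poly_ideal n I"
  proof
    show "mvars p \<subseteq> {..<n}" if p: "p \<in> I" for p
    proof -
      obtain H where H: "\<forall>j. mvars (H j) \<subseteq> {..<n}" "p = (\<Sum>j<r. H j * fL j)"
        using p unfolding I_def by blast
      show ?thesis
        unfolding H(2) using H(1) vars_L by (intro mvars_sum mvars_mult) simp_all
    qed
    show "0 \<in> I"
      unfolding I_def by (intro CollectI exI[of _ "\<lambda>_. 0"]) simp
    show "p + q \<in> I" if pq: "p \<in> I" "q \<in> I" for p q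
    proof -
      obtain H G where "\<forall>j. mvars (H j) \<subseteq> {..<n}" "\<forall>j. mvars (G j) \<subseteq> {..<n}"
        "p = (\<Sum>j<r. H j * fL j)" "q = (\<Sum>j<r. G j * fL j)"
        using pq unfolding I_def by blast
      then show ?thesis unfolding I_def
        by (intro CollectI exI[of _ "\<lambda>j. H j + G j"]) (simp add: distrib_right sum.distrib mvars_add)
    qed
    show "a * p \<in> I" if a: "mvars a \<subseteq> {..<n}" and p: "p \<in> I" for a p
    proof -
      obtain H where "\<forall>j. mvars (H j) \<subseteq> {..<n}" "p = (\<Sum>j<r. H j * fL j)"
        using p unfolding I_def by blast
      then show ?thesis unfolding I_def using a
        by (intro CollectI exI[of _ "\<lambda>j. a * H j"]) (simp add: mult.assoc sum_distrib_left mvars_mult)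
    qed
  qed
  interpret poly_ideal n I by (rule I)
  have homogeneous_component_I: "homogeneous_component e p \<in> I" if "p \<in> I" for p e
  proof -
    obtain H where H: "\<forall>j. mvars (H j) \<subseteq> {..<n}" "p = (\<Sum>j<r. H j * fL j)"
      using \<open>p \<in> I\<close> unfolding I_def by blast
    \<comment> \<open>Since f_j is homogeneous of degree \<open>d j\<close>, the part of degree
      \<open>e\<close> of the product comes from the part of degree \<open>e - d j\<close> of the
      multiplier. Writing the condition as a sum gives the zero part when \<open>d j\<close> exceeds
      \<open>e\<close>.\<close>
    have "homogeneous_component e (H j * fL j) = mrestrict {m. wdeg (\<lambda>_. 1) m + int (d j) = int e} (H j) * fL j" if "j < r" for j
      unfolding homogeneous_component_def mult.commute[of _ "fL j"]
      by (rule mrestrict_mult) (use hom[OF that] in \<open>auto simp: fL_def keys_map_to_ac\<close>)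
    then have "homogeneous_component e p = (\<Sum>j<r. mrestrict {m. wdeg (\<lambda>_. 1) m + int (d j) = int e} (H j) * fL j)"
      unfolding H(2) by (simp add: homogeneous_component_def mrestrict_sum)
    then show ?thesis
      using H(1) unfolding I_def
      by (intro CollectI exI[of _ "\<lambda>j. mrestrict {m. wdeg (\<lambda>_. 1) m + int (d j) = int e} (H j)"]) (simp add: mvars_mrestrict)
  qed
  have zeros: "a i = 0" if a: "\<And>p. p \<in> I \<Longrightarrow> insertion a p = 0" and "i < n" for a i
  proof -
    have "meval_ac a (f j) = 0" if "j < r" for j
      using a[OF fL_I[OF that]] by (simp add: fL_def insertion_map_to_ac)
    then show ?thesis
      using assms(3) \<open>i < n\<close> unfolding no_common_zero_def by blast
  qed
  have "\<exists>k. mvar l ^ k \<in> I" if "l < n" for l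
    using I homogeneous_component_I zeros that by (rule projective_nullstellensatz)
  then obtain k where k: "\<And>l. l < n \<Longrightarrow> mvar l ^ k l \<in> I"
    by metis
  \<comment> \<open>One exponent for all variables; the successor ensures that it is
    positive.\<close>
  define N where "N = Suc (\<Sum>l<n. k l)"
  have "mvar l ^ N \<in> I" if "l < n" for l
  proof -
    have "k l \<le> N"
      using that member_le_sum[of l "{..<n}" k] by (simp add: N_def)
    then have "mvar l ^ N = mvar l ^ (N - k l) * (mvar l ^ k l :: 'k alg_closure mpol)"
      by (simp flip: power_add)
    then show ?thesis
      using k[OF that] that by (simp add: mult mvars_power)
  qed
  then have "\<forall>l. \<exists>H. l < n \<longrightarrow> (\<forall>j. mvars (H j) \<subseteq> {..<n}) \<and> mvar l ^ N = (\<Sum>j<r. H j * fL j)"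
    unfolding I_def by blast
  then obtain H where H: "\<And>l j. l < n \<Longrightarrow> mvars (H l j) \<subseteq> {..<n}"
      "\<And>l. l < n \<Longrightarrow> mvar l ^ N = (\<Sum>j<r. H l j * fL j)"
    unfolding choice_iff by blast
  obtain \<phi> :: "'k alg_closure \<Rightarrow> 'k" where \<phi>:
    "\<And>x y. \<phi> (x + y) = \<phi> x + \<phi> y" "\<And>c x. \<phi> (to_ac c * x) = c * \<phi> x" "\<phi> 1 = 1"
    using alg_closure_retraction[where 'k = 'k] by blast
  have \<phi>_0: "\<phi> 0 = 0"
    using \<phi>(2)[of 0 0] by simp
  have map_sum: "Poly_Mapping.map \<phi> (sum p A) = (\<Sum>j\<in>A. Poly_Mapping.map \<phi> (p j))"
    for p and A :: "nat set"
    by (rule poly_mapping_eqI, induction A rule: infinite_finite_induct)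
      (simp_all add: lookup_map_poly_mapping \<phi>_0 lookup_add \<phi>)
  \<comment> \<open>The retracted multipliers, cut down to degree \<open>N - d j\<close>.\<close>
  define h where "h l j = mrestrict {m. wdeg (\<lambda>_. 1) m + int (d j) = int N} (Poly_Mapping.map \<phi> (H l j))" for l j
  show ?thesis
  proof
    show "1 \<le> N" by (simp add: N_def)
    show "mvars (h l j) \<subseteq> {..<n}" if "l < n" "j < r" for l j
    proof -
      have "keys (Poly_Mapping.map \<phi> (H l j)) \<subseteq> keys (H l j)"
        by (auto simp: in_keys_iff lookup_map_poly_mapping \<phi>_0 simp del: lookup_not_eq_zero_eq_in_keys)
      then have "mvars (Poly_Mapping.map \<phi> (H l j)) \<subseteq> {..<n}"
        using H(1)[OF that(1), of j] unfolding mvars_def by blast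
      then show ?thesis
        unfolding h_def by (rule mvars_mrestrict)
    qed
    show "wdeg (\<lambda>_. 1) m + int (d j) = int N" if "m \<in> keys (h l j)" for l j m
      using that by (simp add: h_def keys_mrestrict)
    show "mvar l ^ N = (\<Sum>j<r. h l j * f j)" if "l < n" for l
    proof -
      let ?S = "{m. wdeg (\<lambda>_. 1) m = int N}"
      have "Poly_Mapping.map \<phi> (mvar l ^ N) = mvar l ^ N"
        by (simp add: mvar_power \<phi>_0 \<phi>(3))
      then have "mvar l ^ N = mrestrict ?S (Poly_Mapping.map \<phi> (mvar l ^ N))"
        by (simp add: mvar_power mrestrict_ident)
      also have "\<dots> = (\<Sum>j<r. mrestrict ?S (Poly_Mapping.map \<phi> (H l j) * f j))"
        unfolding H(2)[OF that] fL_def by (simp add: map_sum mrestrict_sum map_retraction_mult \<phi>)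
      also have "\<dots> = (\<Sum>j<r. h l j * f j)"
      proof (rule sum.cong[OF refl])
        fix j assume "j \<in> {..<r}"
        then show "mrestrict ?S (Poly_Mapping.map \<phi> (H l j) * f j) = h l j * f j"
          unfolding h_def mult.commute[of _ "f j"]
          by (intro mrestrict_mult) (use hom in auto)
      qed
      finally show ?thesis .
    qed
  qed
qed

section \<open>Exterior multiplication and contraction\<close>

text \<open>The sign from moving dv past the factors with smaller index into its sorted
  position.\<close>

definition koszul_sign :: "nat \<Rightarrow> nat set \<Rightarrow> 'k::comm_ring_1 mpol" where
  "koszul_sign v I = (- 1) ^ card {u \<in> I. u < v}"

lemma koszul_sign_cases: "koszul_sign v I = 1 \<or> koszul_sign v I = - 1"
  unfolding koszul_sign_def by (simp add: minus_one_power_iff)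

lemma koszul_sign_square [simp]: "koszul_sign v I * koszul_sign v I = (1 :: 'k::comm_ring_1 mpol)"
  by (simp add: koszul_sign_def flip: power_mult_distrib)

lemma koszul_sign_square_left [simp]: "koszul_sign v I * (koszul_sign v I * x) = (x :: 'k::comm_ring_1 mpol)"
  by (simp flip: mult.assoc)

lemma koszul_sign_insert:
  assumes "w \<notin> I"
  shows "koszul_sign v (insert w I) = (if w < v then - koszul_sign v I else koszul_sign v I)"
proof (cases "w < v")
  case True
  then have "{u \<in> insert w I. u < v} = insert w {u \<in> I. u < v}" by auto
  moreover have "finite {u \<in> I. u < v}"
    by (rule finite_subset[of _ "{..<v}"]) auto
  ultimately show ?thesis
    using assms True by (simp add: koszul_sign_def)
next
  case False
  then have "{u \<in> insert w I. u < v} = {u \<in> I. u < v}" by auto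
  then show ?thesis using False by (simp add: koszul_sign_def)
qed

lemma koszul_sign_remove:
  assumes "w \<in> I"
  shows "koszul_sign v (I - {w}) = (if w < v then - koszul_sign v I else koszul_sign v I :: 'k::comm_ring_1 mpol)"
  using koszul_sign_insert[of w "I - {w}" v, where 'a = 'k] assms by (auto simp: insert_absorb)

text \<open>Left multiplication by dv. The value 0 at infinite index sets agrees with
  \<open>wedge\<close>, where the sum over an infinite power set is 0.\<close>

definition wedge_var :: "nat \<Rightarrow> 'k dform \<Rightarrow> 'k::comm_ring_1 dform" where
  "wedge_var v \<omega> = (\<lambda>I. if finite I \<and> v \<in> I then koszul_sign v I * \<omega> (I - {v}) else 0)"

text \<open>The interior product with the vector field \<partial>/\<partial>v.\<close>

definition contract_var :: "nat \<Rightarrow> 'k dform \<Rightarrow> 'k::comm_ring_1 dform" where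
  "contract_var v \<omega> = (\<lambda>I. if finite I \<and> v \<notin> I then koszul_sign v I * \<omega> (insert v I) else 0)"

lemma wedge_var_wedge_var_same: "wedge_var v (wedge_var v \<omega>) I = 0"
  by (simp add: wedge_var_def)

lemma wedge_var_wedge_var: "v \<noteq> w \<Longrightarrow> wedge_var v (wedge_var w \<omega>) I = - wedge_var w (wedge_var v \<omega>) I"
proof -
  assume "v \<noteq> w"
  moreover have "I - {v} - {w} = I - {w} - {v}" by auto
  ultimately show ?thesis
    by (auto simp: wedge_var_def koszul_sign_remove mult_ac)
qed

text \<open>Only one summand contributes: the first if \<open>v\<close> is not in \<open>I\<close>,
  the second if it is. The two signs that occur in it are equal and cancel.\<close>

lemma contract_var_wedge_var_same: "finite I \<Longrightarrow> contract_var v (wedge_var v \<omega>) I + wedge_var v (contract_var v \<omega>) I = \<omega> I"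
  by (auto simp: wedge_var_def contract_var_def koszul_sign_remove koszul_sign_insert insert_absorb)

lemma contract_var_wedge_var: "v \<noteq> w \<Longrightarrow> contract_var v (wedge_var w \<omega>) I + wedge_var w (contract_var v \<omega>) I = 0"
proof -
  assume "v \<noteq> w"
  moreover from this have "insert v I - {w} = insert v (I - {w})" by auto
  ultimately show ?thesis
    by (auto simp: wedge_var_def contract_var_def koszul_sign_remove koszul_sign_insert mult_ac)
qed

definition wedge_1form :: "nat set \<Rightarrow> (nat \<Rightarrow> 'k mpol) \<Rightarrow> 'k dform \<Rightarrow> 'k::comm_ring_1 dform" where
  "wedge_1form V g \<omega> = (\<lambda>I. \<Sum>v\<in>V. g v * wedge_var v \<omega> I)"

definition contraction :: "nat set \<Rightarrow> (nat \<Rightarrow> 'k mpol) \<Rightarrow> 'k dform \<Rightarrow> 'k::comm_ring_1 dform" where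
  "contraction V h \<omega> = (\<lambda>I. \<Sum>v\<in>V. h v * contract_var v \<omega> I)"

lemma wedge_var_linear_sum: "wedge_var v (\<lambda>I. \<Sum>w\<in>V. h w * F w I) I = (\<Sum>w\<in>V. h w * wedge_var v (F w) I)"
  by (auto simp: wedge_var_def sum_distrib_left mult_ac)

lemma contract_var_linear_sum: "contract_var v (\<lambda>I. \<Sum>w\<in>V. h w * F w I) I = (\<Sum>w\<in>V. h w * contract_var v (F w) I)"
  by (auto simp: contract_var_def sum_distrib_left mult_ac)

lemma sum_alternating:
  fixes a :: "'a \<Rightarrow> 'a \<Rightarrow> 'b::ab_group_add"
  assumes "finite V" "\<And>v. a v v = 0" "\<And>v w. v \<noteq> w \<Longrightarrow> a v w = - a w v"
  shows "(\<Sum>v\<in>V. \<Sum>w\<in>V. a v w) = 0"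
  using assms(1)
proof (induction V)
  case (insert x V)
  have "(\<Sum>v\<in>V. a v x) = (\<Sum>v\<in>V. - a x v)"
    using insert.hyps by (intro sum.cong refl assms(3)) auto
  then show ?case
    using insert by (simp add: sum.distrib assms(2) sum_negf)
qed simp

lemma wedge_1form_wedge_1form:
  assumes "finite V"
  shows "wedge_1form V g (wedge_1form V g \<omega>) = 0"
proof
  fix I
  have "wedge_1form V g (wedge_1form V g \<omega>) I = (\<Sum>v\<in>V. \<Sum>w\<in>V. g v * (g w * wedge_var v (wedge_var w \<omega>) I))"
    unfolding wedge_1form_def by (simp add: wedge_var_linear_sum sum_distrib_left)
  also have "\<dots> = 0"
  proof (rule sum_alternating[OF assms])
    show "g v * (g w * wedge_var v (wedge_var w \<omega>) I) = - (g w * (g v * wedge_var w (wedge_var v \<omega>) I))" if "v \<noteq> w" for v w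
      using wedge_var_wedge_var[OF that, of \<omega> I] by (simp add: mult.left_commute)
  qed (simp add: wedge_var_wedge_var_same)
  finally show "wedge_1form V g (wedge_1form V g \<omega>) I = 0 I" by simp
qed

text \<open>Contraction is an antiderivation: terms with different indices cancel in pairs, and the
  diagonal ones add up to the pairing of the vector field \<open>h\<close> with the 1-form
  \<open>g\<close>.\<close>

lemma wedge_1form_contraction:
  assumes "finite V" "finite I"
  shows "wedge_1form V g (contraction V h \<omega>) I + contraction V h (wedge_1form V g \<omega>) I = (\<Sum>v\<in>V. h v * g v) * \<omega> I"
proof -
  have "wedge_1form V g (contraction V h \<omega>) I + contraction V h (wedge_1form V g \<omega>) I =
      (\<Sum>v\<in>V. \<Sum>w\<in>V. g v * (h w * wedge_var v (contract_var w \<omega>) I)) +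
      (\<Sum>w\<in>V. \<Sum>v\<in>V. h w * (g v * contract_var w (wedge_var v \<omega>) I))"
    unfolding wedge_1form_def contraction_def by (simp add: wedge_var_linear_sum contract_var_linear_sum sum_distrib_left)
  also have "(\<Sum>w\<in>V. \<Sum>v\<in>V. h w * (g v * contract_var w (wedge_var v \<omega>) I)) =
      (\<Sum>v\<in>V. \<Sum>w\<in>V. h w * (g v * contract_var w (wedge_var v \<omega>) I))"
    by (rule sum.swap)
  also have "(\<Sum>v\<in>V. \<Sum>w\<in>V. g v * (h w * wedge_var v (contract_var w \<omega>) I)) + \<dots> =
      (\<Sum>v\<in>V. \<Sum>w\<in>V. h w * g v * (contract_var w (wedge_var v \<omega>) I + wedge_var v (contract_var w \<omega>) I))"
    by (simp add: sum.distrib distrib_left mult_ac add_ac)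
  also have "\<dots> = (\<Sum>v\<in>V. \<Sum>w\<in>V. if v = w then h v * g v * \<omega> I else 0)"
    using assms by (intro sum.cong refl) (auto simp: contract_var_wedge_var_same contract_var_wedge_var)
  also have "\<dots> = (\<Sum>v\<in>V. h v * g v) * \<omega> I"
    using assms by (simp add: sum_distrib_right)
  finally show ?thesis .
qed

lemma wedge_var_add: "wedge_var v (\<alpha> + \<beta>) = wedge_var v \<alpha> + wedge_var v \<beta>"
  by (auto simp: wedge_var_def fun_eq_iff distrib_left)

lemma wedge_var_scale: "wedge_var v ((\<lambda>_. a) * \<omega>) = (\<lambda>_. a) * wedge_var v \<omega>"
  by (auto simp: wedge_var_def fun_eq_iff mult_ac)

lemma wedge_1form_add: "wedge_1form V g (\<alpha> + \<beta>) = wedge_1form V g \<alpha> + wedge_1form V g \<beta>"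
  by (simp add: wedge_1form_def wedge_var_add fun_eq_iff distrib_left sum.distrib)

lemma wedge_1form_scale: "wedge_1form V g ((\<lambda>_. a) * \<omega>) = (\<lambda>_. a) * wedge_1form V g \<omega>"
  by (auto simp: wedge_1form_def wedge_var_scale sum_distrib_left mult.left_commute)

lemma wedge_1form_diff: "wedge_1form V g (\<alpha> - \<beta>) = wedge_1form V g \<alpha> - wedge_1form V g \<beta>"
  using wedge_1form_add[of V g "\<alpha> - \<beta>" \<beta>] by (simp add: algebra_simps)

section \<open>Partial derivatives and the exterior derivative\<close>

lemma mpderiv_add: "mpderiv v (p + q) = mpderiv v p + mpderiv v q"
  unfolding mpderiv_def
  by (rule setsum_keys_plus_distrib[where f = "\<lambda>m c. single (m - single v 1) (of_nat (lookup m v) * c)"])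
    (simp_all add: distrib_left single_add)

lemma mpderiv_0 [simp]: "mpderiv v 0 = 0"
  by (simp add: mpderiv_def)

lemma mpderiv_sum: "mpderiv v (sum f A) = (\<Sum>i\<in>A. mpderiv v (f i))"
  by (induction A rule: infinite_finite_induct) (auto simp: mpderiv_add)

lemma mpderiv_single: "mpderiv v (single m c) = single (m - single v 1) (of_nat (lookup m v) * c)"
  by (auto simp: mpderiv_def)

lemma mpderiv_eq_0: "v \<notin> mvars p \<Longrightarrow> mpderiv v p = 0"
  unfolding mpderiv_def
  by (rule sum.neutral) (auto simp: mvars_def in_keys_iff simp del: lookup_not_eq_zero_eq_in_keys)

text \<open>The variable \<open>v\<close> has exponent exactly 1 in every monomial of the product,
  so the factor produced by differentiation is 1 in every characteristic.\<close>

lemma mpderiv_mvar_mult: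
  assumes "v \<notin> mvars p"
  shows "mpderiv v (mvar v * p) = (p :: 'k::comm_ring_1 mpol)"
proof (induction p rule: mpol_induct)
  case (single m c)
  then have "lookup m v = 0"
    using assms by (auto simp: mvars_def in_keys_iff)
  then show ?case
    by (simp add: mvar_def mult_single mpderiv_single lookup_add)
qed (simp_all add: distrib_left mpderiv_add)

text \<open>Only this inclusion holds in general: in positive characteristic the exponent factor can
  kill a monomial.\<close>

lemma keys_mpderiv:
  assumes "m \<in> keys (mpderiv v p)"
  shows "m + single v 1 \<in> keys p"
proof -
  have "keys (mpderiv v p) \<subseteq> (\<Union>m\<in>keys p. keys (single (m - single v 1) (of_nat (lookup m v) * lookup p m)))"
    unfolding mpderiv_def by (rule keys_sum)
  with assms obtain m' where m': "m' \<in> keys p" "m = m' - single v 1" "of_nat (lookup m' v) * lookup p m' \<noteq> 0"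
    by (auto split: if_splits)
  then have "lookup m' v \<noteq> 0"
    by (intro notI) simp
  then have "m + single v 1 = m'"
    unfolding m'(2) by (intro poly_mapping_eqI) (auto simp: lookup_add lookup_minus lookup_single when_def)
  with m' show ?thesis by simp
qed

lemma inversions_singleton: "inversions {v} (I - {v}) = card {u \<in> I. u < v}"
proof -
  have "{(a, b). a \<in> {v} \<and> b \<in> I - {v} \<and> b < a} = Pair v ` {u \<in> I. u < v}" by auto
  then show ?thesis
    by (simp add: inversions_def card_image inj_on_def)
qed

text \<open>Only singletons \<open>A\<close> contribute to the wedge product with a 1-form, and for
  them the inversion sign is the Koszul sign. Indices outside \<open>V\<close> have derivative
  0.\<close>

lemma wedge_ext_deriv:
  assumes "mvars p \<subseteq> V" "finite V"
  shows "wedge (ext_deriv p) \<omega> = wedge_1form V (\<lambda>v. mpderiv v p) \<omega>"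
proof
  fix I
  show "wedge (ext_deriv p) \<omega> I = wedge_1form V (\<lambda>v. mpderiv v p) \<omega> I"
  proof (cases "finite I")
    case False
    then show ?thesis
      by (simp add: wedge_def wedge_1form_def wedge_var_def)
  next
    case True
    have "wedge (ext_deriv p) \<omega> I =
        (\<Sum>A\<in>(\<lambda>v. {v}) ` I. (- 1) ^ inversions A (I - A) * ext_deriv p A * \<omega> (I - A))"
      unfolding wedge_def using True
      by (intro sum.mono_neutral_right) (auto simp: ext_deriv_def is_singleton_def)
    also have "\<dots> = (\<Sum>v\<in>I. (- 1) ^ inversions {v} (I - {v}) * mpderiv v p * \<omega> (I - {v}))"
      by (subst sum.reindex) (simp_all add: ext_deriv_def)
    also have "\<dots> = (\<Sum>v\<in>I. mpderiv v p * wedge_var v \<omega> I)"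
      using True by (intro sum.cong) (auto simp: wedge_var_def koszul_sign_def inversions_singleton)
    also have "\<dots> = (\<Sum>v\<in>I \<inter> V. mpderiv v p * wedge_var v \<omega> I)"
      using True assms(1) mpderiv_eq_0[of _ p] by (intro sum.mono_neutral_right) fastforce+
    also have "\<dots> = (\<Sum>v\<in>V. mpderiv v p * wedge_var v \<omega> I)"
      using assms by (intro sum.mono_neutral_left) (auto simp: wedge_var_def)
    finally show ?thesis by (simp add: wedge_1form_def)
  qed
qed

section \<open>Bigraded components and their projections\<close>

lemma keys_eq_empty_iff: "keys p = {} \<longleftrightarrow> p = 0"
  by (auto simp: in_keys_iff intro!: poly_mapping_eqI)

lemma keys_mult_koszul_sign:
  "keys (a * koszul_sign v I) = keys (a :: 'k::comm_ring_1 mpol)"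
proof (rule disjE[OF koszul_sign_cases[of v I, where 'a = 'k]])
  assume "koszul_sign v I = (- 1 :: 'k mpol)"
  then have "a * koszul_sign v I = - a" by (metis mult_minus1_right)
  then show ?thesis by (simp add: keys_def)
qed simp

text \<open>The monomials m for which m dv_I is a basis element of the given bigraded piece;
  membership of a form becomes a condition on the support of each coefficient.\<close>

definition bimonomials :: "nat \<Rightarrow> nat \<Rightarrow> (nat \<Rightarrow> nat) \<Rightarrow> int \<Rightarrow> int \<Rightarrow> int \<Rightarrow> nat set \<Rightarrow> (nat \<Rightarrow>\<^sub>0 nat) set" where
  "bimonomials n r d k q p I = {m. I \<subseteq> {..<n + r} \<and> int (card I) = k \<and> keys m \<subseteq> {..<n + r} \<and>
     wdeg (vdeg1 n d) m + (\<Sum>v\<in>I. vdeg1 n d v) = q \<and> wdeg (vdeg2 n) m + (\<Sum>v\<in>I. vdeg2 n v) = p}"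

lemma biforms_iff: "\<omega> \<in> biforms n r d k q p \<longleftrightarrow> (\<forall>I. keys (\<omega> I) \<subseteq> bimonomials n r d k q p I)"
proof -
  have "\<omega> I \<noteq> 0 \<longleftrightarrow> (\<exists>m. m \<in> keys (\<omega> I))" for I
    by (metis ex_in_conv keys_eq_empty_iff)
  then show ?thesis
    unfolding biforms_def kforms_def bimonomials_def term_deg_def wdeg_def mvars_subset_iff by blast
qed

definition biproject :: "nat \<Rightarrow> nat \<Rightarrow> (nat \<Rightarrow> nat) \<Rightarrow> int \<Rightarrow> int \<Rightarrow> int \<Rightarrow> 'k dform \<Rightarrow> 'k::comm_ring_1 dform" where
  "biproject n r d k q p \<omega> = (\<lambda>I. mrestrict (bimonomials n r d k q p I) (\<omega> I))"

lemma biproject_in: "biproject n r d k q p \<omega> \<in> biforms n r d k q p"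
  by (simp add: biforms_iff biproject_def keys_mrestrict)

lemma biproject_ident: "\<omega> \<in> biforms n r d k q p \<Longrightarrow> biproject n r d k q p \<omega> = \<omega>"
  by (simp add: biforms_iff biproject_def mrestrict_ident)

lemma biproject_add: "biproject n r d k q p (\<alpha> + \<beta>) = biproject n r d k q p \<alpha> + biproject n r d k q p \<beta>"
  by (simp add: biproject_def mrestrict_add fun_eq_iff)

lemma biproject_diff: "biproject n r d k q p (\<alpha> - \<beta>) = biproject n r d k q p \<alpha> - biproject n r d k q p \<beta>"
  using biproject_add[of n r d k q p "\<alpha> - \<beta>" \<beta>] by (simp add: eq_diff_eq)

text \<open>As a fixed-point condition, membership is preserved by every operator that commutes with
  the projections up to a shift of degrees.\<close>

lemma biforms_iff_biproject: "\<omega> \<in> biforms n r d k q p \<longleftrightarrow> biproject n r d k q p \<omega> = \<omega>"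
  using biproject_in[of n r d k q p \<omega>] biproject_ident[of \<omega>] by metis

lemma biforms_add: "\<alpha> \<in> biforms n r d k q p \<Longrightarrow> \<beta> \<in> biforms n r d k q p \<Longrightarrow> \<alpha> + \<beta> \<in> biforms n r d k q p"
  for \<alpha> \<beta> :: "'k::comm_ring_1 dform"
  by (simp add: biforms_iff_biproject biproject_add)

lemma biforms_diff: "\<alpha> \<in> biforms n r d k q p \<Longrightarrow> \<beta> \<in> biforms n r d k q p \<Longrightarrow> \<alpha> - \<beta> \<in> biforms n r d k q p"
  for \<alpha> \<beta> :: "'k::comm_ring_1 dform"
  by (simp add: biforms_iff_biproject biproject_diff)

lemma biproject_scale:
  assumes "\<And>m. m \<in> keys a \<Longrightarrow> keys m \<subseteq> {..<n + r} \<and> wdeg (vdeg1 n d) m = q' \<and> wdeg (vdeg2 n) m = p'"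
  shows "biproject n r d k (q + q') (p + p') ((\<lambda>_. a) * \<omega>) = (\<lambda>_. a) * biproject n r d k q p \<omega>"
  unfolding biproject_def fun_eq_iff times_fun_apply
  by (intro allI mrestrict_mult) (auto simp: bimonomials_def keys_plus_nat dest!: assms)

lemma biproject_mconst: "biproject n r d k q p ((\<lambda>_. mconst c) * \<omega>) = (\<lambda>_. mconst c) * biproject n r d k q p \<omega>"
proof -
  have "biproject n r d k (q + 0) (p + 0) ((\<lambda>_. mconst c) * \<omega>) = (\<lambda>_. mconst c) * biproject n r d k q p \<omega>"
    by (rule biproject_scale) (auto simp: mconst_def split: if_splits)
  then show ?thesis by simp
qed

lemma biforms_mconst: "\<omega> \<in> biforms n r d k q p \<Longrightarrow> (\<lambda>_. mconst c) * \<omega> \<in> biforms n r d k q p"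
  for \<omega> :: "'k::comm_ring_1 dform"
  by (simp add: biforms_iff_biproject biproject_mconst)

lemma biforms_0: "0 \<in> biforms n r d k q p"
  by (simp add: biforms_iff)

lemma biforms_finite: "\<omega> \<in> biforms n r d k q p \<Longrightarrow> infinite I \<Longrightarrow> \<omega> I = 0"
  unfolding biforms_iff bimonomials_def using finite_subset[of I "{..<n + r}"]
  by (metis (mono_tags, lifting) ex_in_conv finite_lessThan keys_eq_empty_iff mem_Collect_eq subsetD)

text \<open>The hypothesis says that the 1-form has bidegree (0,1): the degrees of g_v and dv add up
  to this for every \<open>v\<close>.\<close>

lemma biproject_wedge_1form:
  assumes g: "\<And>v m. v < n + r \<Longrightarrow> m \<in> keys (g v) \<Longrightarrow>
    keys m \<subseteq> {..<n + r} \<and> wdeg (vdeg1 n d) m = - vdeg1 n d v \<and> wdeg (vdeg2 n) m = 1 - vdeg2 n v"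
  shows "biproject n r d (k + 1) q (p + 1) (wedge_1form {..<n + r} g \<omega>) = wedge_1form {..<n + r} g (biproject n r d k q p \<omega>)"
proof
  fix I
  have "mrestrict (bimonomials n r d (k + 1) q (p + 1) I) (g v * wedge_var v \<omega> I) =
      g v * wedge_var v (biproject n r d k q p \<omega>) I" if v: "v < n + r" for v
  proof (cases "finite I \<and> v \<in> I")
    case True
    have "mrestrict (bimonomials n r d (k + 1) q (p + 1) I) (g v * koszul_sign v I * \<omega> (I - {v})) =
      g v * koszul_sign v I * mrestrict (bimonomials n r d k q p (I - {v})) (\<omega> (I - {v}))"
    proof (rule mrestrict_mult)
      fix m m' assume "m \<in> keys (g v * koszul_sign v I)"
      then have m: "keys m \<subseteq> {..<n + r}" "wdeg (vdeg1 n d) m = - vdeg1 n d v" "wdeg (vdeg2 n) m = 1 - vdeg2 n v"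
        using g[OF v] by (auto simp: keys_mult_koszul_sign)
      have "I \<subseteq> {..<n + r} \<longleftrightarrow> I - {v} \<subseteq> {..<n + r}" using v by auto
      moreover have "card I = Suc (card (I - {v}))"
        using True card_Suc_Diff1[of I v] by simp
      moreover have "sum w I = w v + sum w (I - {v})" for w :: "nat \<Rightarrow> int"
        using True by (simp add: sum.remove)
      ultimately show "m + m' \<in> bimonomials n r d (k + 1) q (p + 1) I \<longleftrightarrow> m' \<in> bimonomials n r d k q p (I - {v})"
        using m by (auto simp: bimonomials_def keys_plus_nat)
    qed
    then show ?thesis
      using True by (simp add: wedge_var_def biproject_def mult.assoc)
  qed (auto simp: wedge_var_def)
  then show "biproject n r d (k + 1) q (p + 1) (wedge_1form {..<n + r} g \<omega>) I = wedge_1form {..<n + r} g (biproject n r d k q p \<omega>) I"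
    unfolding biproject_def[of n r d "k + 1"] wedge_1form_def by (simp add: mrestrict_sum)
qed

text \<open>Here the vector field with components h_v has bidegree (e,-1).\<close>

lemma biproject_contraction:
  assumes h: "\<And>v m. v < n + r \<Longrightarrow> m \<in> keys (h v) \<Longrightarrow>
    keys m \<subseteq> {..<n + r} \<and> wdeg (vdeg1 n d) m = e + vdeg1 n d v \<and> wdeg (vdeg2 n) m = vdeg2 n v - 1"
  shows "biproject n r d k (q + e) p (contraction {..<n + r} h \<omega>) = contraction {..<n + r} h (biproject n r d (k + 1) q (p + 1) \<omega>)"
proof
  fix I
  have "mrestrict (bimonomials n r d k (q + e) p I) (h v * contract_var v \<omega> I) =
      h v * contract_var v (biproject n r d (k + 1) q (p + 1) \<omega>) I" if v: "v < n + r" for v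
  proof (cases "finite I \<and> v \<notin> I")
    case True
    have "mrestrict (bimonomials n r d k (q + e) p I) (h v * koszul_sign v I * \<omega> (insert v I)) =
      h v * koszul_sign v I * mrestrict (bimonomials n r d (k + 1) q (p + 1) (insert v I)) (\<omega> (insert v I))"
    proof (rule mrestrict_mult)
      fix m m' assume "m \<in> keys (h v * koszul_sign v I)"
      then have m: "keys m \<subseteq> {..<n + r}" "wdeg (vdeg1 n d) m = e + vdeg1 n d v" "wdeg (vdeg2 n) m = vdeg2 n v - 1"
        using h[OF v] by (auto simp: keys_mult_koszul_sign)
      show "m + m' \<in> bimonomials n r d k (q + e) p I \<longleftrightarrow> m' \<in> bimonomials n r d (k + 1) q (p + 1) (insert v I)"
        using m v True by (auto simp: bimonomials_def keys_plus_nat)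
    qed
    then show ?thesis
      using True by (simp add: contract_var_def biproject_def mult.assoc)
  qed (auto simp: contract_var_def)
  then show "biproject n r d k (q + e) p (contraction {..<n + r} h \<omega>) I = contraction {..<n + r} h (biproject n r d (k + 1) q (p + 1) \<omega>) I"
    unfolding biproject_def[of n r d k] contraction_def by (simp add: mrestrict_sum)
qed

section \<open>The ideal of the powers x_0^N, ..., x_{l-1}^N and forms with coefficients in
  it\<close>

definition power_ideal :: "nat \<Rightarrow> nat \<Rightarrow> 'k::zero mpol set" where
  "power_ideal N l = {p. \<forall>m\<in>keys p. \<exists>i<l. N \<le> lookup m i}"

lemma power_ideal_0 [simp]: "0 \<in> power_ideal N l"
  by (simp add: power_ideal_def)

lemma power_ideal_add: "p \<in> power_ideal N l \<Longrightarrow> q \<in> power_ideal N l \<Longrightarrow> p + q \<in> power_ideal N (l :: nat)"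
  for p q :: "'k::comm_ring_1 mpol"
  using keys_add[of p q] unfolding power_ideal_def by blast

lemma power_ideal_mult: "p \<in> power_ideal N l \<Longrightarrow> a * p \<in> power_ideal N (l :: nat)"
  for p a :: "'k::comm_ring_1 mpol"
  using keys_mult[of a p] unfolding power_ideal_def by (fastforce simp: lookup_add intro: trans_le_add2)

lemma power_ideal_uminus: "p \<in> power_ideal N l \<Longrightarrow> - p \<in> power_ideal N (l :: nat)"
  for p :: "'k::comm_ring_1 mpol"
  using power_ideal_mult[of p N l "-1"] by simp

lemma power_ideal_diff: "p \<in> power_ideal N l \<Longrightarrow> q \<in> power_ideal N l \<Longrightarrow> p - q \<in> power_ideal N (l :: nat)"
  for p q :: "'k::comm_ring_1 mpol"
  using power_ideal_add[of p N l "- q"] power_ideal_uminus[of q N l] by simp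

lemma power_ideal_sum: "(\<And>i. i \<in> A \<Longrightarrow> f i \<in> power_ideal N l) \<Longrightarrow> sum f A \<in> power_ideal N l"
  for f :: "'a \<Rightarrow> 'k::comm_ring_1 mpol"
  by (induction A rule: infinite_finite_induct) (auto intro: power_ideal_add)

lemma power_ideal_mrestrict: "p \<in> power_ideal N l \<Longrightarrow> mrestrict S p \<in> power_ideal N l"
  by (auto simp: power_ideal_def keys_mrestrict)

lemma power_ideal_Suc: "p \<in> power_ideal N l \<Longrightarrow> p \<in> power_ideal N (Suc l)"
  by (auto simp: power_ideal_def less_Suc_eq)

lemma lookup_mvar_power_mult:
  "lookup (mvar l ^ N * p) (single l N + m) = lookup (p :: 'k::comm_ring_1 mpol) m"
proof (induction p rule: mpol_induct)
  case (single m' c)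
  then show ?case
    by (simp add: mvar_power mult_single lookup_single when_def)
qed (simp_all add: distrib_left lookup_add)

lemma power_ideal_mvar_power_mult: "mvar l ^ N * p \<in> power_ideal N (Suc l)" for p :: "'k::comm_ring_1 mpol"
proof -
  have "mvar l ^ N \<in> (power_ideal N (Suc l) :: 'k mpol set)"
    by (auto simp: power_ideal_def mvar_power)
  from power_ideal_mult[OF this, of p] show ?thesis by (simp add: mult.commute)
qed

text \<open>x_l^N is a nonzerodivisor modulo the powers of the preceding variables: multiplying by
  it leaves the exponents of x_0, ..., x_{l-1} unchanged.\<close>

lemma power_ideal_cancel:
  fixes p :: "'k::comm_ring_1 mpol"
  assumes "mvar l ^ N * p \<in> power_ideal N l"
  shows "p \<in> power_ideal N l"
  unfolding power_ideal_def
proof safe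
  fix m assume "m \<in> keys p"
  then have "single l N + m \<in> keys (mvar l ^ N * p)"
    by (simp add: in_keys_iff lookup_mvar_power_mult)
  then obtain i where "i < l" "N \<le> lookup (single l N + m) i"
    using assms by (auto simp: power_ideal_def)
  then show "\<exists>i<l. N \<le> lookup m i"
    by (auto simp: lookup_add lookup_single when_def)
qed

text \<open>Collect in \<open>b\<close> the monomials divisible by x_l^N, after division; the others
  are divisible by an earlier power.\<close>

lemma power_ideal_Suc_split:
  fixes p :: "'k::comm_ring_1 mpol"
  assumes "p \<in> power_ideal N (Suc l)"
  shows "\<exists>b. p - mvar l ^ N * b \<in> power_ideal N l"
proof (induction p rule: mpol_induct)
  case (single m c)
  then obtain i where i: "i \<le> l" "N \<le> lookup m i"
    using assms by (auto simp: power_ideal_def less_Suc_eq_le)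
  show ?case
  proof (cases "i = l")
    case True
    then have "m = single l N + (m - single l N)"
      using i by (intro poly_mapping_eqI) (auto simp: lookup_add lookup_minus lookup_single when_def)
    then have "single m c - mvar l ^ N * single (m - single l N) c = 0"
      by (simp add: mvar_power mult_single)
    then show ?thesis by (metis power_ideal_0)
  next
    case False
    then have "single m c - mvar l ^ N * 0 \<in> power_ideal N l"
      using i by (auto simp: power_ideal_def intro!: exI[of _ i])
    then show ?thesis by blast
  qed
next
  case (add p q)
  then obtain a b where "p - mvar l ^ N * a \<in> power_ideal N l" "q - mvar l ^ N * b \<in> power_ideal N l"
    by blast
  then have "(p + q) - mvar l ^ N * (a + b) \<in> power_ideal N l"
    using power_ideal_add[of "p - mvar l ^ N * a" N l "q - mvar l ^ N * b"] by (simp add: algebra_simps)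
  then show ?case by blast
next
  case zero
  show ?case by (rule exI[of _ 0]) simp
qed

text \<open>The submodule by which \<Omega> is divided to obtain \<Omega>_l. Congruences modulo it
  replace the quotient complex.\<close>

definition power_forms :: "nat \<Rightarrow> nat \<Rightarrow> 'k::zero dform \<Rightarrow> bool" where
  "power_forms N l \<omega> \<longleftrightarrow> (\<forall>I. \<omega> I \<in> power_ideal N l)"

lemma power_forms_0 [simp]: "power_forms N l 0"
  by (simp add: power_forms_def)

lemma power_forms_add: "power_forms N l \<alpha> \<Longrightarrow> power_forms N l \<beta> \<Longrightarrow> power_forms N l (\<alpha> + \<beta>)" for \<alpha> \<beta> :: "'k::comm_ring_1 dform"
  by (simp add: power_forms_def power_ideal_add)

lemma power_forms_diff: "power_forms N l \<alpha> \<Longrightarrow> power_forms N l \<beta> \<Longrightarrow> power_forms N l (\<alpha> - \<beta>)" for \<alpha> \<beta> :: "'k::comm_ring_1 dform"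
  by (simp add: power_forms_def power_ideal_diff)

lemma power_forms_scale: "power_forms N l \<alpha> \<Longrightarrow> power_forms N l ((\<lambda>_. a) * \<alpha>)" for \<alpha> :: "'k::comm_ring_1 dform"
  by (simp add: power_forms_def power_ideal_mult)

lemma power_forms_Suc: "power_forms N l \<alpha> \<Longrightarrow> power_forms N (Suc l) \<alpha>"
  by (simp add: power_forms_def power_ideal_Suc)

lemma power_forms_mvar_power: "power_forms N (Suc l) ((\<lambda>_. mvar l ^ N) * \<alpha>)" for \<alpha> :: "'k::comm_ring_1 dform"
  by (simp add: power_forms_def power_ideal_mvar_power_mult)

lemma power_forms_cancel: "power_forms N l ((\<lambda>_. mvar l ^ N) * \<alpha>) \<Longrightarrow> power_forms N l \<alpha>" for \<alpha> :: "'k::comm_ring_1 dform"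
  by (auto simp: power_forms_def intro: power_ideal_cancel)

lemma power_forms_Suc_split:
  fixes \<alpha> :: "'k::comm_ring_1 dform"
  assumes "power_forms N (Suc l) \<alpha>"
  obtains \<beta> where "power_forms N l (\<alpha> - (\<lambda>_. mvar l ^ N) * \<beta>)"
proof -
  have "\<forall>I. \<exists>b. \<alpha> I - mvar l ^ N * b \<in> power_ideal N l"
    using assms power_ideal_Suc_split unfolding power_forms_def by blast
  then obtain \<beta> where "\<forall>I. \<alpha> I - mvar l ^ N * \<beta> I \<in> power_ideal N l"
    unfolding choice_iff by blast
  then show ?thesis
    by (intro that[of \<beta>]) (simp add: power_forms_def)
qed

lemma power_forms_biproject: "power_forms N l \<alpha> \<Longrightarrow> power_forms N l (biproject n r d k q p \<alpha>)"
  by (simp add: power_forms_def biproject_def power_ideal_mrestrict)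

lemma power_forms_wedge_1form: "power_forms N l \<alpha> \<Longrightarrow> power_forms N l (wedge_1form V g \<alpha>)"
  by (auto simp: power_forms_def wedge_1form_def wedge_var_def intro!: power_ideal_sum power_ideal_mult)

lemma power_forms_contraction: "power_forms N l \<alpha> \<Longrightarrow> power_forms N l (contraction V g \<alpha>)"
  by (auto simp: power_forms_def contraction_def contract_var_def intro!: power_ideal_sum power_ideal_mult)

section \<open>The Koszul complex modulo powers of the variables\<close>

lemma wdeg_vdeg1: "keys m \<subseteq> {..<n} \<Longrightarrow> wdeg (vdeg1 n d) m = wdeg (\<lambda>_. 1) m"
  by (auto simp: wdeg_def vdeg1_def intro!: sum.cong)

lemma wdeg_vdeg2: "keys m \<subseteq> {..<n} \<Longrightarrow> wdeg (vdeg2 n) m = 0"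
  by (auto simp: wdeg_def vdeg2_def intro!: sum.neutral)

lemma mhomogeneous_wdeg: "mhomogeneous e p \<longleftrightarrow> (\<forall>m\<in>keys p. wdeg (\<lambda>_. 1) m = int e)"
  by (simp add: mhomogeneous_def wdeg_def flip: of_nat_sum)

locale nullstellensatz_certificate =
  fixes n r N :: nat and d :: "nat \<Rightarrow> nat" and f :: "nat \<Rightarrow> 'k::field mpol"
    and h :: "nat \<Rightarrow> nat \<Rightarrow> 'k mpol"
  assumes vars_f: "j < r \<Longrightarrow> mvars (f j) \<subseteq> {..<n}"
    and d_pos: "j < r \<Longrightarrow> 1 \<le> d j"
    and hom_f: "j < r \<Longrightarrow> mhomogeneous (d j) (f j)"
    and N_pos: "1 \<le> N"
    and vars_h: "l < n \<Longrightarrow> j < r \<Longrightarrow> mvars (h l j) \<subseteq> {..<n}"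
    and deg_h: "l < n \<Longrightarrow> j < r \<Longrightarrow> m \<in> keys (h l j) \<Longrightarrow> wdeg (\<lambda>_. 1) m + int (d j) = int N"
    and power_eq: "l < n \<Longrightarrow> mvar l ^ N = (\<Sum>j<r. h l j * f j)"
begin

abbreviation B :: "int \<Rightarrow> int \<Rightarrow> int \<Rightarrow> 'k dform set" where
  "B \<equiv> biforms n r d"

abbreviation pr :: "int \<Rightarrow> int \<Rightarrow> int \<Rightarrow> 'k dform \<Rightarrow> 'k dform" where
  "pr \<equiv> biproject n r d"

abbreviation var_power :: "nat \<Rightarrow> 'k dform" where
  "var_power l \<equiv> (\<lambda>I. mvar l ^ N)"

abbreviation J :: "nat \<Rightarrow> 'k dform \<Rightarrow> bool" where
  "J \<equiv> power_forms N"

definition D :: "'k dform \<Rightarrow> 'k dform" where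
  "D = wedge_1form {..<n + r} (\<lambda>v. mpderiv v (Fpoly n r f))"

text \<open>Contraction with the vector field whose component along \<partial>/\<partial>y_j is
  h_lj; index n + j stands for y_j.\<close>

definition sigma :: "nat \<Rightarrow> 'k dform \<Rightarrow> 'k dform" where
  "sigma l = contraction {..<n + r} (\<lambda>v. if v < n then 0 else h l (v - n))"

text \<open>F has bidegree (0,1): the degree d_j of f_j cancels the first degree -d_j of
  y_j.\<close>

lemma keys_Fpoly:
  assumes "m \<in> keys (Fpoly n r f)"
  shows "keys m \<subseteq> {..<n + r}" "wdeg (vdeg1 n d) m = 0" "wdeg (vdeg2 n) m = 1"
proof -
  obtain j where j: "j < r" "m \<in> keys (mvar (n + j) * f j)"
    using assms keys_sum[of "\<lambda>j. mvar (n + j) * f j" "{..<r}"] by (auto simp: Fpoly_def)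
  then obtain m' where m': "m = single (n + j) 1 + m'" "m' \<in> keys (f j)"
    using keys_mult[of "mvar (n + j)" "f j"] by (auto simp: mvar_def)
  then have "keys m' \<subseteq> {..<n}" "wdeg (\<lambda>_. 1) m' = int (d j)"
    using vars_f[OF j(1)] hom_f[OF j(1)] by (auto simp: mvars_subset_iff mhomogeneous_wdeg)
  then show "keys m \<subseteq> {..<n + r}" "wdeg (vdeg1 n d) m = 0" "wdeg (vdeg2 n) m = 1"
    using j by (auto simp: m' keys_plus_nat wdeg_vdeg1 wdeg_vdeg2 vdeg1_def vdeg2_def)
qed

lemma D_eq: "D = bdry n r f"
proof -
  have "mvars (Fpoly n r f) \<subseteq> {..<n + r}"
    using keys_Fpoly(1) by (auto simp: mvars_subset_iff)
  then show ?thesis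
    by (auto simp: D_def bdry_def wedge_ext_deriv fun_eq_iff)
qed

lemma pr_D: "pr (k + 1) q (p + 1) (D \<omega>) = D (pr k q p \<omega>)"
  unfolding D_def
proof (rule biproject_wedge_1form)
  fix v m assume "m \<in> keys (mpderiv v (Fpoly n r f))"
  from keys_Fpoly[OF keys_mpderiv[OF this]]
  show "keys m \<subseteq> {..<n + r} \<and> wdeg (vdeg1 n d) m = - vdeg1 n d v \<and> wdeg (vdeg2 n) m = 1 - vdeg2 n v"
    by (simp add: keys_plus_nat)
qed

lemma D_in: "\<omega> \<in> B k q p \<Longrightarrow> D \<omega> \<in> B (k + 1) q (p + 1)"
  by (simp add: biforms_iff_biproject pr_D)

lemma pr_sigma: "l < n \<Longrightarrow> pr k (q + int N) p (sigma l \<omega>) = sigma l (pr (k + 1) q (p + 1) \<omega>)"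
  unfolding sigma_def
proof (rule biproject_contraction)
  fix v m assume "l < n" "v < n + r" "m \<in> keys (if v < n then 0 else h l (v - n))"
  then have "\<not> v < n" "v - n < r" "m \<in> keys (h l (v - n))"
    by (auto split: if_splits)
  moreover from this have "keys m \<subseteq> {..<n}"
    using vars_h[OF \<open>l < n\<close>] by (auto simp: mvars_subset_iff)
  ultimately show "keys m \<subseteq> {..<n + r} \<and> wdeg (vdeg1 n d) m = int N + vdeg1 n d v \<and> wdeg (vdeg2 n) m = vdeg2 n v - 1"
    using deg_h[OF \<open>l < n\<close>, of "v - n" m] by (auto simp: wdeg_vdeg1 wdeg_vdeg2 vdeg1_def vdeg2_def)
qed

lemma sigma_in: "l < n \<Longrightarrow> \<omega> \<in> B (k + 1) q (p + 1) \<Longrightarrow> sigma l \<omega> \<in> B k (q + int N) p"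
  by (simp add: biforms_iff_biproject pr_sigma)

lemma pr_var_power: "l < n \<Longrightarrow> pr k (q + int N) p (var_power l * \<omega>) = var_power l * pr k q p \<omega>"
  using biproject_scale[of "mvar l ^ N" n r d "int N" 0 k q p \<omega>]
  by (auto simp: mvar_power vdeg1_def vdeg2_def split: if_splits)

lemma var_power_in: "l < n \<Longrightarrow> \<omega> \<in> B k q p \<Longrightarrow> var_power l * \<omega> \<in> B k (q + int N) p"
  by (simp add: biforms_iff_biproject pr_var_power)

lemma D_add: "D (\<alpha> + \<beta>) = D \<alpha> + D \<beta>"
  by (simp add: D_def wedge_1form_add)

lemma D_diff: "D (\<alpha> - \<beta>) = D \<alpha> - D \<beta>"
  by (simp add: D_def wedge_1form_diff)

lemma D_scale: "D ((\<lambda>_. a) * \<alpha>) = (\<lambda>_. a) * D \<alpha>"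
  by (simp add: D_def wedge_1form_scale)

lemma D_D: "D (D \<omega>) = 0"
  by (simp add: D_def wedge_1form_wedge_1form)

lemma J_D: "J m \<alpha> \<Longrightarrow> J m (D \<alpha>)"
  by (simp add: D_def power_forms_wedge_1form)

lemma J_sigma: "J m \<alpha> \<Longrightarrow> J m (sigma l \<alpha>)"
  by (simp add: sigma_def power_forms_contraction)

text \<open>The f_i involve only the x-variables, so y_j occurs in F only through y_j f_j.\<close>

lemma mpderiv_Fpoly: "j < r \<Longrightarrow> mpderiv (n + j) (Fpoly n r f) = f j"
proof -
  assume j: "j < r"
  have "mpderiv (n + j) (mvar (n + i) * f i) = (if i = j then f i else 0)" if "i < r" for i
  proof (cases "i = j")
    case True
    then show ?thesis
      using vars_f[OF that] by (auto intro!: mpderiv_mvar_mult)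
  next
    case False
    have "mvars (mvar (n + i) * f i) \<subseteq> {n + i} \<union> {..<n}"
      using vars_f[OF that] by (intro mvars_mult) auto
    with False have "n + j \<notin> mvars (mvar (n + i) * f i)" by auto
    then show ?thesis
      using False by (simp add: mpderiv_eq_0)
  qed
  then show ?thesis
    using j by (simp add: Fpoly_def mpderiv_sum)
qed

text \<open>The pairing of the vector field with dF is the sum of the h_lj f_j, which is x_l^N.
  Infinite index sets are treated separately: there both sides vanish.\<close>

lemma homotopy:
  assumes "l < n" "\<omega> \<in> B k q p"
  shows "D (sigma l \<omega>) + sigma l (D \<omega>) = var_power l * \<omega>"
proof
  fix I
  show "(D (sigma l \<omega>) + sigma l (D \<omega>)) I = (var_power l * \<omega>) I"
  proof (cases "finite I")
    case True
    have "(\<Sum>v<n + r. (if v < n then 0 else h l (v - n)) * mpderiv v (Fpoly n r f)) =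
        (\<Sum>v\<in>{n..<n + r}. h l (v - n) * mpderiv v (Fpoly n r f))"
      by (rule sum.mono_neutral_cong_right) auto
    also have "\<dots> = (\<Sum>j<r. h l j * f j)"
      by (rule sum.reindex_bij_witness[of _ "\<lambda>j. n + j" "\<lambda>v. v - n"]) (auto simp flip: mpderiv_Fpoly)
    finally show ?thesis
      using True assms by (simp add: D_def sigma_def wedge_1form_contraction power_eq)
  next
    case False
    then show ?thesis
      using biforms_finite[OF assms(2) False]
      by (simp add: D_def sigma_def wedge_1form_def contraction_def wedge_var_def contract_var_def)
  qed
qed

text \<open>Cocycles of \<Omega>_m, represented by forms in \<Omega>.\<close>

definition cocycles_mod :: "nat \<Rightarrow> int \<Rightarrow> int \<Rightarrow> int \<Rightarrow> 'k dform set" where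
  "cocycles_mod m k q p = {\<omega> \<in> B k q p. J m (D \<omega>)}"

text \<open>The primitive \<open>\<alpha>\<close> need not be bihomogeneous: \<^const>\<open>biproject\<close> commutes with \<open>D\<close> and makes it so.\<close>

definition coboundaries_mod :: "nat \<Rightarrow> 'k dform set" where
  "coboundaries_mod m = {\<omega>. \<exists>\<alpha>. J m (\<omega> - D \<alpha>)}"

text \<open>The connecting map sends \<omega>' to D\<omega>' divided by x_m^N, modulo the lower
  powers. As \<open>D\<close> and \<open>sigma m\<close> anticommute up to x_m^N,
  \<open>sigma m \<omega>\<close> is a preimage of \<omega>, so this map is surjective.\<close>

lemma sigma_lift:
  assumes "m < n" "\<omega> \<in> cocycles_mod m (k + 1) q (p + 1)"
  shows "J m (D (sigma m \<omega>) - var_power m * \<omega>)" "sigma m \<omega> \<in> cocycles_mod (Suc m) k (q + int N) p"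
proof -
  have \<omega>: "\<omega> \<in> B (k + 1) q (p + 1)" "J m (D \<omega>)"
    using assms by (auto simp: cocycles_mod_def)
  have "D (sigma m \<omega>) - var_power m * \<omega> = 0 - sigma m (D \<omega>)"
    by (simp flip: homotopy[OF assms(1) \<omega>(1)])
  then show *: "J m (D (sigma m \<omega>) - var_power m * \<omega>)"
    using \<omega>(2) by (simp only: power_forms_diff J_sigma power_forms_0)
  have "J (Suc m) ((D (sigma m \<omega>) - var_power m * \<omega>) + var_power m * \<omega>)"
    by (intro power_forms_add power_forms_Suc[OF *] power_forms_mvar_power)
  then show "sigma m \<omega> \<in> cocycles_mod (Suc m) k (q + int N) p"
    using sigma_in[OF assms(1) \<omega>(1)] by (simp add: cocycles_mod_def)
qed

text \<open>The connecting map respects coboundaries. If \<omega>' is congruent to D\<alpha> + x_m^N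
  \<beta>, apply \<open>D\<close> and cancel x_m^N to see that \<omega> is congruent to
  D\<beta>.\<close>

lemma coboundaries_mod_descend:
  assumes "J m (D \<omega>' - var_power m * \<omega>)" "\<omega>' \<in> coboundaries_mod (Suc m)"
  shows "\<omega> \<in> coboundaries_mod m"
proof -
  obtain \<alpha> where "J (Suc m) (\<omega>' - D \<alpha>)"
    using assms(2) by (auto simp: coboundaries_mod_def)
  then obtain \<beta> where "J m (\<omega>' - D \<alpha> - var_power m * \<beta>)"
    by (rule power_forms_Suc_split)
  then have "J m (D (\<omega>' - D \<alpha> - var_power m * \<beta>))"
    by (rule J_D)
  then have "J m (D \<omega>' - var_power m * D \<beta>)"
    by (simp only: D_diff D_D D_scale diff_zero)
  then have "J m (D \<omega>' - var_power m * D \<beta> - (D \<omega>' - var_power m * \<omega>))"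
    using assms(1) by (rule power_forms_diff)
  also have "D \<omega>' - var_power m * D \<beta> - (D \<omega>' - var_power m * \<omega>) = var_power m * (\<omega> - D \<beta>)"
    by (simp add: algebra_simps)
  finally have "J m (\<omega> - D \<beta>)"
    by (rule power_forms_cancel)
  then show ?thesis by (auto simp: coboundaries_mod_def)
qed

lemma vanishing_step:
  assumes "m < n" "cocycles_mod (Suc m) k (q + int N) p \<subseteq> coboundaries_mod (Suc m)"
  shows "cocycles_mod m (k + 1) q (p + 1) \<subseteq> coboundaries_mod m"
  using sigma_lift[OF assms(1)] coboundaries_mod_descend assms(2) by blast

definition one_dim :: "nat \<Rightarrow> int \<Rightarrow> int \<Rightarrow> int \<Rightarrow> bool" where
  "one_dim m k q p \<longleftrightarrow> (\<exists>\<gamma>\<in>cocycles_mod m k q p. \<gamma> \<notin> coboundaries_mod m \<and> (\<forall>\<omega>\<in>cocycles_mod m k q p. \<exists>c. \<omega> - (\<lambda>_. mconst c) * \<gamma> \<in> coboundaries_mod m))"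

text \<open>The kernel of the surjective connecting map is the image of the cohomology of \<Omega>_m
  in first degree q + N. By \<open>van\<close> this is zero, so the map is an isomorphism.\<close>

lemma one_dim_step:
  assumes m: "m < n" and dim: "one_dim (Suc m) k (q + int N) p"
    and van: "cocycles_mod m k (q + int N) p \<subseteq> coboundaries_mod m"
  shows "one_dim m (k + 1) q (p + 1)"
proof -
  obtain \<gamma>' where \<gamma>': "\<gamma>' \<in> cocycles_mod (Suc m) k (q + int N) p" "\<gamma>' \<notin> coboundaries_mod (Suc m)"
    and span: "\<And>\<omega>. \<omega> \<in> cocycles_mod (Suc m) k (q + int N) p \<Longrightarrow> \<exists>c. \<omega> - (\<lambda>_. mconst c) * \<gamma>' \<in> coboundaries_mod (Suc m)"
    using dim unfolding one_dim_def by blast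
  then have \<gamma>'_in: "\<gamma>' \<in> B k (q + int N) p" and "J (Suc m) (D \<gamma>')"
    by (auto simp: cocycles_mod_def)
  \<comment> \<open>The image of \<gamma>' under the connecting map; projecting it gives the
    representative \<gamma> in the right bidegree.\<close>
  then obtain \<gamma>0 where \<gamma>0: "J m (D \<gamma>' - var_power m * \<gamma>0)"
    by (metis power_forms_Suc_split)
  define \<gamma> where "\<gamma> = pr (k + 1) q (p + 1) \<gamma>0"
  have \<gamma>: "J m (D \<gamma>' - var_power m * \<gamma>)"
    using power_forms_biproject[OF \<gamma>0, of n r d "k + 1" "q + int N" "p + 1"] biproject_ident[OF D_in[OF \<gamma>'_in]]
    by (simp add: biproject_diff pr_var_power[OF m] \<gamma>_def)
  have "J m (var_power m * D \<gamma>)"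
  proof -
    have "J m (0 - D (D \<gamma>' - var_power m * \<gamma>))"
      by (intro power_forms_diff power_forms_0 J_D \<gamma>)
    then show ?thesis by (simp add: D_diff D_D D_scale)
  qed
  then have \<gamma>_cocycles_mod: "\<gamma> \<in> cocycles_mod m (k + 1) q (p + 1)"
    using power_forms_cancel by (auto simp: cocycles_mod_def \<gamma>_def biproject_in)
  \<comment> \<open>Injectivity: if \<gamma> is congruent to D\<alpha>, then \<gamma>' - x_m^N
    \<alpha> is a cocycle already at level \<open>m\<close>, hence a coboundary by
    \<open>van\<close>, and \<gamma>' would be one at level \<open>Suc m\<close>.\<close>
  have "\<gamma> \<notin> coboundaries_mod m"
  proof
    assume "\<gamma> \<in> coboundaries_mod m"
    then obtain \<alpha>0 where \<alpha>0: "J m (\<gamma> - D \<alpha>0)"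
      by (auto simp: coboundaries_mod_def)
    define \<alpha> where "\<alpha> = pr k q p \<alpha>0"
    have "pr (k + 1) q (p + 1) (\<gamma> - D \<alpha>0) = \<gamma> - D \<alpha>"
      using biproject_ident[OF biproject_in] by (simp add: biproject_diff pr_D \<alpha>_def \<gamma>_def)
    then have \<alpha>: "J m (\<gamma> - D \<alpha>)"
      using power_forms_biproject[OF \<alpha>0] by metis
    have "D (\<gamma>' - var_power m * \<alpha>) = (D \<gamma>' - var_power m * \<gamma>) + var_power m * (\<gamma> - D \<alpha>)"
      unfolding D_diff D_scale by (simp add: algebra_simps)
    then have "J m (D (\<gamma>' - var_power m * \<alpha>))"
      using \<gamma> \<alpha> by (simp only: power_forms_add power_forms_scale)
    moreover have "\<gamma>' - var_power m * \<alpha> \<in> B k (q + int N) p"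
      unfolding \<alpha>_def by (intro biforms_diff \<gamma>'_in var_power_in m biproject_in)
    ultimately have "\<gamma>' - var_power m * \<alpha> \<in> coboundaries_mod m"
      using van by (auto simp: cocycles_mod_def)
    then obtain \<beta> where "J m (\<gamma>' - var_power m * \<alpha> - D \<beta>)"
      by (auto simp: coboundaries_mod_def)
    then have "J (Suc m) (\<gamma>' - var_power m * \<alpha> - D \<beta> + var_power m * \<alpha>)"
      by (intro power_forms_add power_forms_Suc power_forms_mvar_power)
    then have "J (Suc m) (\<gamma>' - D \<beta>)"
      by (simp add: algebra_simps)
    then show False
      using \<gamma>'(2) by (auto simp: coboundaries_mod_def)
  qed
  moreover have "\<exists>c. \<omega> - (\<lambda>_. mconst c) * \<gamma> \<in> coboundaries_mod m" if \<omega>: "\<omega> \<in> cocycles_mod m (k + 1) q (p + 1)" for \<omega>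
  proof -
    \<comment> \<open>The scalar is that of the preimage \<open>sigma m \<omega>\<close> relative to
      \<gamma>'; the connecting map carries the relation down.\<close>
    obtain c where c: "sigma m \<omega> - (\<lambda>_. mconst c) * \<gamma>' \<in> coboundaries_mod (Suc m)"
      using span[OF sigma_lift(2)[OF m \<omega>]] by blast
    have "D (sigma m \<omega> - (\<lambda>_. mconst c) * \<gamma>') - var_power m * (\<omega> - (\<lambda>_. mconst c) * \<gamma>) =
        (D (sigma m \<omega>) - var_power m * \<omega>) - (\<lambda>_. mconst c) * (D \<gamma>' - var_power m * \<gamma>)"
      unfolding D_diff D_scale by (simp add: algebra_simps)
    moreover have "J m \<dots>"
      by (intro power_forms_diff sigma_lift(1)[OF m \<omega>] power_forms_scale \<gamma>)
    ultimately have "\<omega> - (\<lambda>_. mconst c) * \<gamma> \<in> coboundaries_mod m"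
      using coboundaries_mod_descend[OF _ c] by simp
    then show ?thesis by blast
  qed
  ultimately show ?thesis
    using \<gamma>_cocycles_mod unfolding one_dim_def by blast
qed

section \<open>The base case: top degree of \<Omega>_n\<close>

lemma top_monomial:
  assumes m: "m \<in> bimonomials n r d k q p I" "\<And>i. i < n \<Longrightarrow> lookup m i < N" and q: "q \<ge> int n * int N"
  shows "q = int n * int N" "I = {..<n}" "\<And>v. lookup m v = (if v < n then N - 1 else 0)"
proof -
  \<comment> \<open>The contribution of the variable v and of dv to the first degree. It is at most
    (N - 1) + 1 = N for an x-variable and at most 0 for a y-variable, so q \<ge> nN forces equality
    throughout.\<close>
  define t where "t v = (int (lookup m v) + (if v \<in> I then 1 else 0)) * vdeg1 n d v" for v
  have IV: "I \<subseteq> {..<n + r}" and mV: "keys m \<subseteq> {..<n + r}"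
    and deg: "wdeg (vdeg1 n d) m + (\<Sum>v\<in>I. vdeg1 n d v) = q"
    using m by (auto simp: bimonomials_def)
  have "(\<Sum>v\<in>I. vdeg1 n d v) = (\<Sum>v<n + r. if v \<in> I then vdeg1 n d v else 0)"
    using IV by (intro sum.mono_neutral_cong_left) auto
  then have q_sum: "q = (\<Sum>v<n + r. t v)"
    using mV deg unfolding t_def distrib_right sum.distrib
    by (subst (asm) wdeg_superset[of "{..<n + r}"]) (simp_all add: if_distrib[of "\<lambda>x. x * _"] cong: if_cong)
  define b where "b v = (if v < n then int N else 0)" for v
  have b_sum: "(\<Sum>v<n + r. b v) = int n * int N"
  proof -
    have "(\<Sum>v<n + r. b v) = (\<Sum>v<n. int N)"
      unfolding b_def by (rule sum.mono_neutral_cong_right) auto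
    then show ?thesis by simp
  qed
  have t_le: "t v \<le> b v" if "v < n + r" for v
  proof (cases "v < n")
    case True
    then show ?thesis using m(2)[of v] by (auto simp: t_def b_def vdeg1_def)
  next
    case False
    then show ?thesis by (auto simp: t_def b_def vdeg1_def)
  qed
  have t_eq: "t v = b v" if "v < n + r" for v
  proof (rule ccontr)
    assume "t v \<noteq> b v"
    then have "t v < b v" using t_le[OF that] by simp
    then have "(\<Sum>v<n + r. t v) < (\<Sum>v<n + r. b v)"
      using t_le that by (intro sum_strict_mono_ex1) auto
    then show False using q q_sum b_sum by simp
  qed
  show "q = int n * int N"
    using t_eq q_sum b_sum by simp
  have small: "lookup m v = N - 1 \<and> v \<in> I" if "v < n" for v
    using t_eq[of v] that m(2)[OF that] by (auto simp: t_def b_def vdeg1_def split: if_splits)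
  \<comment> \<open>Positive d_j make the weight of y_j strictly negative, so contribution 0
    excludes both y_j and dy_j.\<close>
  have large: "lookup m v = 0 \<and> v \<notin> I" if "v < n + r" "\<not> v < n" for v
  proof -
    have "v - n < r" using that by simp
    with t_eq[of v] that d_pos[of "v - n"] show ?thesis
      by (auto simp: t_def b_def vdeg1_def split: if_splits)
  qed
  show "I = {..<n}"
    using small large IV by (auto simp: subset_iff not_less) (meson leD not_less)
  show "lookup m v = (if v < n then N - 1 else 0)" for v
  proof (cases "v < n + r")
    case True
    then show ?thesis using small[of v] large[of v] by auto
  next
    case False
    then have "v \<notin> keys m" using mV by auto
    with False show ?thesis by (simp add: in_keys_iff)
  qed
qed

definition top_mon :: "nat \<Rightarrow>\<^sub>0 nat" where
  "top_mon = (\<Sum>i<n. single i (N - 1))"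

lemma lookup_top_mon: "lookup top_mon v = (if v < n then N - 1 else 0)"
  by (simp add: top_mon_def lookup_sum lookup_single when_def)

lemma keys_top_mon: "keys top_mon \<subseteq> {..<n}"
  by (auto simp: in_keys_iff lookup_top_mon split: if_splits)

lemma top_mon_in: "top_mon \<in> bimonomials n r d (int n) (int n * int N) 0 {..<n}"
proof -
  have "wdeg (\<lambda>_. 1) top_mon = (\<Sum>i<n. int (lookup top_mon i))"
    using wdeg_superset[OF _ keys_top_mon] by simp
  also have "\<dots> = int n * (int N - 1)"
    using N_pos by (simp add: lookup_top_mon of_nat_diff)
  finally have "wdeg (vdeg1 n d) top_mon = int n * int N - int n"
    using keys_top_mon by (simp add: wdeg_vdeg1 algebra_simps)
  then show ?thesis
    using keys_top_mon by (auto simp: bimonomials_def wdeg_vdeg2 vdeg1_def vdeg2_def)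
qed

lemma top_form:
  assumes "m \<in> keys (\<omega> I)" "\<omega> \<in> B k q p" "q \<ge> int n * int N" "\<And>i. i < n \<Longrightarrow> lookup m i < N"
  shows "q = int n * int N" "I = {..<n}" "m = top_mon" "k = int n" "p = 0"
proof -
  have m: "m \<in> bimonomials n r d k q p I"
    using assms(1,2) by (auto simp: biforms_iff)
  show *: "q = int n * int N" "I = {..<n}"
    using top_monomial[OF m assms(4,3)] by auto
  show "m = top_mon"
    using top_monomial(3)[OF m assms(4,3)] by (intro poly_mapping_eqI) (simp add: lookup_top_mon)
  then show "k = int n" "p = 0"
    using m top_mon_in * by (auto simp: bimonomials_def)
qed

text \<open>In first degree at least nN, every term other than the top monomial times dx_0 ...
  dx_{n-1} contains some x_i with exponent at least N.\<close>

lemma J_top: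
  assumes "\<omega> \<in> B k q p" "q \<ge> int n * int N"
    and "\<not> (q = int n * int N \<and> k = int n \<and> p = 0) \<or> lookup (\<omega> {..<n}) top_mon = 0"
  shows "J n \<omega>"
  unfolding power_forms_def power_ideal_def
proof (intro allI CollectI ballI, rule ccontr)
  fix I m assume m: "m \<in> keys (\<omega> I)" and "\<not> (\<exists>i<n. N \<le> lookup m i)"
  then have "lookup m i < N" if "i < n" for i
    using that by (simp add: not_le)
  note top_form[OF m assms(1,2) this]
  then show False
    using assms(3) m by (simp add: in_keys_iff)
qed

lemma vanishing_top:
  assumes "q \<ge> int n * int N" "\<not> (q = int n * int N \<and> k = int n \<and> p = 0)"
  shows "cocycles_mod n k q p \<subseteq> coboundaries_mod n"
proof
  fix \<omega> assume "\<omega> \<in> cocycles_mod n k q p"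
  then have \<omega>: "\<omega> \<in> B k q p" by (simp add: cocycles_mod_def)
  have "J n \<omega>"
    using J_top[OF \<omega> assms(1)] assms(2) by blast
  then have "J n (\<omega> - D 0)"
    by (metis D_diff diff_self diff_zero)
  then show "\<omega> \<in> coboundaries_mod n" by (auto simp: coboundaries_mod_def)
qed

lemma one_dim_top: "one_dim n (int n) (int n * int N) 0"
proof -
  define \<gamma> :: "'k dform" where "\<gamma> = (\<lambda>I. if I = {..<n} then single top_mon 1 else 0)"
  have \<gamma>_in: "\<gamma> \<in> B (int n) (int n * int N) 0"
    using top_mon_in by (auto simp: biforms_iff \<gamma>_def)
  have "J n (D \<gamma>)"
    using J_top[OF D_in[OF \<gamma>_in]] by simp
  then have \<gamma>_cocycles_mod: "\<gamma> \<in> cocycles_mod n (int n) (int n * int N) 0"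
    using \<gamma>_in by (simp add: cocycles_mod_def)
  have "\<gamma> \<notin> coboundaries_mod n"
  proof
    assume "\<gamma> \<in> coboundaries_mod n"
    then obtain \<alpha> where \<alpha>: "J n (\<gamma> - D \<alpha>)"
      by (auto simp: coboundaries_mod_def)
    \<comment> \<open>A homogeneous primitive of \<gamma> would have second degree -1, but no form
      has negative second degree.\<close>
    have "bimonomials n r d (int n - 1) (int n * int N) (- 1) I = {}" for I
    proof -
      have "wdeg (vdeg2 n) m + (\<Sum>v\<in>I. vdeg2 n v) \<noteq> - 1" for m
      proof -
        have "0 \<le> wdeg (vdeg2 n) m" "0 \<le> (\<Sum>v\<in>I. vdeg2 n v)"
          by (auto simp: wdeg_def vdeg2_def intro!: sum_nonneg)
        then show ?thesis by simp
      qed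
      then show ?thesis unfolding bimonomials_def by blast
    qed
    then have "pr (int n - 1) (int n * int N) (- 1) \<alpha> = 0"
      by (simp add: biproject_def fun_eq_iff mrestrict_disjoint)
    then have "pr (int n) (int n * int N) 0 (D \<alpha>) = D 0"
      using pr_D[of "int n - 1" "int n * int N" "- 1" \<alpha>] by simp
    moreover have "D 0 = 0"
      by (metis D_diff diff_self)
    ultimately have "pr (int n) (int n * int N) 0 (\<gamma> - D \<alpha>) = \<gamma>"
      by (simp add: biproject_diff biproject_ident[OF \<gamma>_in])
    then have "J n \<gamma>"
      using power_forms_biproject[OF \<alpha>] by metis
    then have "single top_mon 1 \<in> (power_ideal N n :: 'k mpol set)"
      unfolding power_forms_def \<gamma>_def by (metis (full_types))
    then show False
      using N_pos by (auto simp: power_ideal_def lookup_top_mon)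
  qed
  moreover have "\<exists>c. \<omega> - (\<lambda>_. mconst c) * \<gamma> \<in> coboundaries_mod n" if "\<omega> \<in> cocycles_mod n (int n) (int n * int N) 0" for \<omega>
  proof -
    define c where "c = lookup (\<omega> {..<n}) top_mon"
    have *: "\<omega> - (\<lambda>_. mconst c) * \<gamma> \<in> B (int n) (int n * int N) 0"
      using that by (intro biforms_diff biforms_mconst \<gamma>_in) (simp add: cocycles_mod_def)
    have "lookup ((\<omega> - (\<lambda>_. mconst c) * \<gamma>) {..<n}) top_mon = 0"
      by (simp add: \<gamma>_def mconst_def mult_single lookup_minus c_def)
    then have "J n (\<omega> - (\<lambda>_. mconst c) * \<gamma>)"
      using J_top[OF *] by simp
    then have "J n (\<omega> - (\<lambda>_. mconst c) * \<gamma> - D 0)"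
      by (metis D_diff diff_self diff_zero)
    then show ?thesis by (auto simp: coboundaries_mod_def)
  qed
  ultimately show ?thesis
    using \<gamma>_cocycles_mod unfolding one_dim_def by blast
qed

text \<open>Going from level m + 1 to m lowers the first degree by N and raises \<open>k\<close> and
  \<open>p\<close> by 1, so the single surviving class moves from (2n-m-1, n-m-1) to (2n-m,
  n-m).\<close>

lemma all_levels:
  assumes "m \<le> n"
  shows "(\<forall>k q p. q \<ge> int m * int N \<longrightarrow> \<not> (q = int m * int N \<and> k = 2 * int n - int m \<and> p = int n - int m) \<longrightarrow>
      cocycles_mod m k q p \<subseteq> coboundaries_mod m) \<and> one_dim m (2 * int n - int m) (int m * int N) (int n - int m)"
  using assms
proof (induction m rule: inc_induct)
  case base
  show ?case
    using vanishing_top one_dim_top by auto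
next
  case (step m)
  have van: "cocycles_mod m k q p \<subseteq> coboundaries_mod m"
    if "q \<ge> int m * int N" "\<not> (q = int m * int N \<and> k = 2 * int n - int m \<and> p = int n - int m)" for k q p
  proof -
    have "cocycles_mod (Suc m) (k - 1) (q + int N) (p - 1) \<subseteq> coboundaries_mod (Suc m)"
      using step.IH that by (auto simp: distrib_right)
    from vanishing_step[OF step.hyps(2) this] show ?thesis by simp
  qed
  moreover have "one_dim m (2 * int n - int (Suc m) + 1) (int m * int N) (int n - int (Suc m) + 1)"
  proof (rule one_dim_step[OF step.hyps(2)])
    show "one_dim (Suc m) (2 * int n - int (Suc m)) (int m * int N + int N) (int n - int (Suc m))"
      using step.IH by (simp add: distrib_right add.commute)
    \<comment> \<open>The first degree (m+1)N exceeds mN as N is positive, so the vanishing just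
      proved at level \<open>m\<close> applies.\<close>
    show "cocycles_mod m (2 * int n - int (Suc m)) (int m * int N + int N) (int n - int (Suc m)) \<subseteq> coboundaries_mod m"
      using N_pos by (intro van) auto
  qed
  ultimately show ?case by simp
qed

section \<open>Level 0: the original complex\<close>

lemma J_0_iff: "J 0 \<omega> \<longleftrightarrow> \<omega> = 0"
proof -
  have "power_ideal N 0 = {0 :: 'k mpol}"
    by (auto simp: power_ideal_def keys_eq_empty_iff simp flip: ex_in_conv[of "keys _"])
  then show ?thesis by (auto simp: power_forms_def fun_eq_iff)
qed

lemma cocycles_eq: "cocycles n r d f k q p = cocycles_mod 0 k q p"
  by (simp add: cocycles_def cocycles_mod_def J_0_iff D_eq zero_fun_def)

text \<open>Given any primitive of a bihomogeneous form, its projection to degree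
  \<open>k - 1\<close> and bidegree (q, p-1) is again a primitive.\<close>

lemma coboundaries_eq: "coboundaries n r d f k q p = cocycles_mod 0 k q p \<inter> coboundaries_mod 0"
proof -
  have "\<exists>\<alpha>'\<in>B (k - 1) q (p - 1). \<omega> = D \<alpha>'" if "\<omega> \<in> B k q p" "\<omega> = D \<alpha>" for \<omega> \<alpha>
    using pr_D[of "k - 1" q "p - 1" \<alpha>] biproject_ident[OF that(1)] that(2) biproject_in
    by (intro bexI[of _ "pr (k - 1) q (p - 1) \<alpha>"]) auto
  moreover have "D \<alpha> \<in> B k q p" if "\<alpha> \<in> B (k - 1) q (p - 1)" for \<alpha>
    using D_in[OF that] by simp
  ultimately show ?thesis
    by (fastforce simp: coboundaries_def cocycles_mod_def coboundaries_mod_def J_0_iff D_D simp flip: D_eq)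
qed

end

section \<open>Dimension of the quotient\<close>

locale form_quotient =
  fixes V W :: "'k::field dform set"
  assumes V_0: "0 \<in> V" and V_add: "\<alpha> \<in> V \<Longrightarrow> \<beta> \<in> V \<Longrightarrow> \<alpha> + \<beta> \<in> V"
    and V_scale: "\<alpha> \<in> V \<Longrightarrow> (\<lambda>_. mconst c) * \<alpha> \<in> V"
    and W_0: "0 \<in> W" and W_add: "\<alpha> \<in> W \<Longrightarrow> \<beta> \<in> W \<Longrightarrow> \<alpha> + \<beta> \<in> W"
    and W_scale: "\<alpha> \<in> W \<Longrightarrow> (\<lambda>_. mconst c) * \<alpha> \<in> W"
    and W_subset: "W \<subseteq> V"
begin

abbreviation scale :: "'k \<Rightarrow> 'k dform \<Rightarrow> 'k dform" where
  "scale c \<alpha> \<equiv> (\<lambda>I. mconst c) * \<alpha>"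

abbreviation Q :: "('k, 'k dform set) module" where
  "Q \<equiv> quot_module (form_space V) W"

definition C :: "'k dform \<Rightarrow> 'k dform set" where
  "C \<alpha> = (\<lambda>\<beta>. \<beta> + \<alpha>) ` W"

lemma scale_simps:
  "scale (a + b) \<alpha> = scale a \<alpha> + scale b \<alpha>" "scale a (\<alpha> + \<beta>) = scale a \<alpha> + scale a \<beta>"
  "scale (a * b) \<alpha> = scale a (scale b \<alpha>)" "scale 1 \<alpha> = \<alpha>" "scale 0 \<alpha> = 0" "scale a 0 = 0"
  "scale (- 1) \<alpha> = - \<alpha>"
proof -
  have *: "mconst (a + b) = mconst a + mconst b" "mconst (a * b) = mconst a * mconst b"
    "mconst 1 = (1 :: 'k mpol)" "mconst 0 = (0 :: 'k mpol)" "mconst (- 1) = (- 1 :: 'k mpol)"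
    by (simp_all add: mconst_def single_add mult_single single_uminus)
  show "scale (a + b) \<alpha> = scale a \<alpha> + scale b \<alpha>" "scale a (\<alpha> + \<beta>) = scale a \<alpha> + scale a \<beta>"
    "scale (a * b) \<alpha> = scale a (scale b \<alpha>)" "scale 1 \<alpha> = \<alpha>" "scale 0 \<alpha> = 0" "scale a 0 = 0"
    "scale (- 1) \<alpha> = - \<alpha>"
    by (simp_all only: * fun_eq_iff times_fun_apply plus_fun_apply zero_fun_apply uminus_apply)
      (simp_all add: distrib_right distrib_left mult.assoc)
qed

lemma V_uminus: "\<alpha> \<in> V \<Longrightarrow> - \<alpha> \<in> V"
  using V_scale[of \<alpha> "- 1"] by (simp only: scale_simps)

lemma W_uminus: "\<alpha> \<in> W \<Longrightarrow> - \<alpha> \<in> W"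
  using W_scale[of \<alpha> "- 1"] by (simp only: scale_simps)

lemma C_eq_iff: "C \<alpha> = C \<beta> \<longleftrightarrow> \<alpha> - \<beta> \<in> W"
proof
  assume "C \<alpha> = C \<beta>"
  moreover have "0 + \<alpha> \<in> C \<alpha>"
    unfolding C_def using W_0 by blast
  ultimately show "\<alpha> - \<beta> \<in> W"
    by (auto simp: C_def)
next
  have *: "C \<alpha> \<subseteq> C \<beta>" if "\<alpha> - \<beta> \<in> W" for \<alpha> \<beta>
  proof
    fix x assume "x \<in> C \<alpha>"
    then obtain w where "w \<in> W" "x = w + \<alpha>"
      by (auto simp: C_def)
    then have "x = (w + (\<alpha> - \<beta>)) + \<beta>" "w + (\<alpha> - \<beta>) \<in> W"
      using that W_add by auto
    then show "x \<in> C \<beta>" unfolding C_def by blast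
  qed
  assume "\<alpha> - \<beta> \<in> W"
  moreover from W_uminus[OF this] have "\<beta> - \<alpha> \<in> W" by simp
  ultimately show "C \<alpha> = C \<beta>" using * by blast
qed

lemma C_0: "C 0 = W"
  by (auto simp: C_def)

lemma coset_eq: "W +>\<^bsub>form_space V\<^esub> \<alpha> = C \<alpha>"
  by (auto simp: a_r_coset_def' form_space_def C_def plus_fun_def)

lemma carrier_Q: "carrier Q = C ` V"
  by (auto simp: quot_module_def A_RCOSETS_def' coset_eq) (auto simp: form_space_def)

lemma zero_Q: "\<zero>\<^bsub>Q\<^esub> = C 0"
  by (simp add: quot_module_def C_0)

lemma add_Q: "C \<alpha> \<oplus>\<^bsub>Q\<^esub> C \<beta> = C (\<alpha> + \<beta>)"
proof -
  have "C \<alpha> \<oplus>\<^bsub>Q\<^esub> C \<beta> = {x + y | x y. x \<in> C \<alpha> \<and> y \<in> C \<beta>}"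
    by (auto simp: quot_module_def set_add_def' form_space_def plus_fun_def)
  also have "\<dots> = C (\<alpha> + \<beta>)"
  proof safe
    fix x y assume "x \<in> C \<alpha>" "y \<in> C \<beta>"
    then obtain v w where "v \<in> W" "w \<in> W" "x = v + \<alpha>" "y = w + \<beta>"
      by (auto simp: C_def)
    then have "x + y = (v + w) + (\<alpha> + \<beta>)" "v + w \<in> W"
      using W_add by (auto simp: add_ac)
    then show "x + y \<in> C (\<alpha> + \<beta>)" unfolding C_def by blast
  next
    fix x assume "x \<in> C (\<alpha> + \<beta>)"
    then obtain w where "w \<in> W" "x = w + (\<alpha> + \<beta>)"
      by (auto simp: C_def)
    then have "x = (w + \<alpha>) + (0 + \<beta>)" "w + \<alpha> \<in> C \<alpha>" "0 + \<beta> \<in> C \<beta>"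
      using W_0 by (auto simp: C_def add_ac)
    then show "\<exists>y z. x = y + z \<and> y \<in> C \<alpha> \<and> z \<in> C \<beta>" by blast
  qed
  finally show ?thesis .
qed

text \<open>The scalar multiple is defined as a union over all representatives; they all give the
  same coset because \<open>W\<close> is closed under scaling.\<close>

lemma smult_Q: "c \<odot>\<^bsub>Q\<^esub> C \<alpha> = C (scale c \<alpha>)"
proof -
  have "c \<odot>\<^bsub>Q\<^esub> C \<alpha> = (\<Union>x\<in>C \<alpha>. C (scale c x))"
    by (simp add: quot_module_def coset_eq) (simp add: form_space_def times_fun_def)
  also have "\<dots> = (\<Union>x\<in>C \<alpha>. C (scale c \<alpha>))"
  proof (rule SUP_cong[OF refl])
    fix x assume "x \<in> C \<alpha>"
    then obtain w where "w \<in> W" "x = w + \<alpha>"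
      by (auto simp: C_def)
    then show "C (scale c x) = C (scale c \<alpha>)"
      using W_scale[of w c] by (simp add: C_eq_iff scale_simps(2))
  qed
  \<comment> \<open>The index set is nonempty since \<open>W\<close> contains 0.\<close>
  also have "\<dots> = C (scale c \<alpha>)"
    using W_0 by (auto simp: C_def)
  finally show ?thesis .
qed

lemma vectorspace_Q: "vectorspace class_ring Q"
proof -
  have "module class_ring Q"
  proof (rule moduleI)
    show "cring (class_ring :: 'k ring)"
      by (rule class_cring.cring_axioms)
    show "abelian_group Q"
    proof (rule abelian_groupI)
      fix x assume "x \<in> carrier Q"
      then obtain \<alpha> where "\<alpha> \<in> V" "x = C \<alpha>" by (auto simp: carrier_Q)
      then have "C (- \<alpha>) \<in> carrier Q" "C (- \<alpha>) \<oplus>\<^bsub>Q\<^esub> x = \<zero>\<^bsub>Q\<^esub>"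
        by (auto simp: carrier_Q add_Q zero_Q V_uminus)
      then show "\<exists>y\<in>carrier Q. y \<oplus>\<^bsub>Q\<^esub> x = \<zero>\<^bsub>Q\<^esub>" by blast
    qed (auto simp: carrier_Q add_Q zero_Q V_add V_0 add_ac)
  qed (auto simp: carrier_Q add_Q smult_Q V_scale scale_simps)
  moreover have "Ring.field (class_ring :: 'k ring)"
    by (rule class_field.field_axioms)
  ultimately show ?thesis
    by (rule vectorspace.intro)
qed

lemma trivial_Q:
  assumes "V \<subseteq> W"
  shows "carrier Q = {\<zero>\<^bsub>Q\<^esub>}"
proof -
  have "C \<alpha> = C 0" if "\<alpha> \<in> V" for \<alpha>
    using that assms by (auto simp: C_eq_iff)
  then have "C ` V = {C 0}"
    using V_0 by blast
  then show ?thesis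
    by (simp only: carrier_Q zero_Q)
qed

text \<open>One spanning vector, possibly zero in the quotient, treats dimensions 0 and 1
  together.\<close>

lemma fin_dim_Q:
  assumes "\<gamma> \<in> V" "\<And>\<omega>. \<omega> \<in> V \<Longrightarrow> \<exists>c. \<omega> - scale c \<gamma> \<in> W"
  shows "vectorspace.fin_dim class_ring Q"
    and "vectorspace.dim class_ring Q = (if \<gamma> \<in> W then 0 else 1)"
proof -
  interpret Q: vectorspace class_ring Q
    by (rule vectorspace_Q)
  have \<gamma>: "C \<gamma> \<in> carrier Q"
    using assms(1) by (auto simp: carrier_Q)
  have sub: "submodule class_ring (Q.span {C \<gamma>}) Q"
    using \<gamma> by (intro Q.span_is_submodule) auto
  have "carrier Q \<subseteq> Q.span {C \<gamma>}"
  proof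
    fix x assume "x \<in> carrier Q"
    then obtain \<omega> where \<omega>: "\<omega> \<in> V" "x = C \<omega>" by (auto simp: carrier_Q)
    obtain c where "\<omega> - scale c \<gamma> \<in> W" using assms(2)[OF \<omega>(1)] by blast
    then have "x = c \<odot>\<^bsub>Q\<^esub> C \<gamma>"
      by (simp add: \<omega>(2) smult_Q C_eq_iff)
    then show "x \<in> Q.span {C \<gamma>}"
    proof -
      have "C \<gamma> \<in> Q.span {C \<gamma>}"
        using Q.in_own_span[of "{C \<gamma>}"] \<gamma> by (meson empty_subsetI insert_subset singletonI subsetD)
      then have "c \<odot>\<^bsub>Q\<^esub> C \<gamma> \<in> Q.span {C \<gamma>}"
        by (rule submodule.smult_closed[OF sub, rotated]) simp
      then show ?thesis
        by (simp only: \<open>x = c \<odot>\<^bsub>Q\<^esub> C \<gamma>\<close>)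
    qed
  qed
  then have gen: "Q.gen_set {C \<gamma>}"
    using submodule.subset[OF sub] by blast
  then show "Q.fin_dim"
    unfolding Q.fin_dim_def using \<gamma> by (intro exI[of _ "{C \<gamma>}"] conjI gen) simp_all
  show "Q.dim = (if \<gamma> \<in> W then 0 else 1)"
  proof (cases "\<gamma> \<in> W")
    case True
    then have "C \<gamma> = \<zero>\<^bsub>Q\<^esub>" by (simp add: zero_Q C_eq_iff)
    with gen have "Q.gen_set {\<zero>\<^bsub>Q\<^esub>}" by (simp only:)
    from Q.dim0I[OF this] True show ?thesis by (simp only: if_True)
  next
    case False
    then have "C \<gamma> \<noteq> \<zero>\<^bsub>Q\<^esub>" by (simp add: zero_Q C_eq_iff)
    from Q.dim1I[OF gen this \<gamma>] False show ?thesis by (simp only: if_False)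
  qed
qed

end

section \<open>Cohomology in first degree 0\<close>

context nullstellensatz_certificate
begin

lemma form_quotient: "form_quotient (cocycles n r d f k q p) (coboundaries n r d f k q p)"
  unfolding coboundaries_eq cocycles_eq
proof
  have D_0: "D 0 = 0" by (metis D_diff diff_self)
  show cocycles_mod_0: "0 \<in> cocycles_mod 0 k q p"
    by (simp add: cocycles_mod_def biforms_0 D_0)
  show cocycles_mod_add: "\<alpha> + \<beta> \<in> cocycles_mod 0 k q p" if "\<alpha> \<in> cocycles_mod 0 k q p" "\<beta> \<in> cocycles_mod 0 k q p" for \<alpha> \<beta>
    using that by (simp add: cocycles_mod_def biforms_add D_add power_forms_add)
  show cocycles_mod_scale: "(\<lambda>_. mconst c) * \<alpha> \<in> cocycles_mod 0 k q p" if "\<alpha> \<in> cocycles_mod 0 k q p" for \<alpha> c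
    using that by (simp add: cocycles_mod_def biforms_mconst D_scale power_forms_scale)
  have coboundaries_mod_0_iff: "coboundaries_mod 0 = range D"
    by (auto simp: coboundaries_mod_def J_0_iff)
  show "0 \<in> cocycles_mod 0 k q p \<inter> coboundaries_mod 0"
    using cocycles_mod_0 D_0 unfolding coboundaries_mod_0_iff by (metis IntI rangeI)
  show "\<alpha> + \<beta> \<in> cocycles_mod 0 k q p \<inter> coboundaries_mod 0" if "\<alpha> \<in> cocycles_mod 0 k q p \<inter> coboundaries_mod 0" "\<beta> \<in> cocycles_mod 0 k q p \<inter> coboundaries_mod 0" for \<alpha> \<beta>
    using that unfolding coboundaries_mod_0_iff by (auto intro: cocycles_mod_add simp flip: D_add)
  show "(\<lambda>_. mconst c) * \<alpha> \<in> cocycles_mod 0 k q p \<inter> coboundaries_mod 0" if "\<alpha> \<in> cocycles_mod 0 k q p \<inter> coboundaries_mod 0" for \<alpha> c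
    using that unfolding coboundaries_mod_0_iff by (auto intro: cocycles_mod_scale simp flip: D_scale)
qed simp

lemma cohomology_vanishing:
  assumes "k \<noteq> 2 * int n \<or> p \<noteq> int n"
  shows "cocycles n r d f k 0 p \<subseteq> coboundaries n r d f k 0 p"
  using all_levels[of 0] assms by (auto simp: cocycles_eq coboundaries_eq)

lemma cohomology_one_dim:
  obtains \<gamma> where "\<gamma> \<in> cocycles n r d f (2 * int n) 0 (int n)" "\<gamma> \<notin> coboundaries n r d f (2 * int n) 0 (int n)"
    "\<And>\<omega>. \<omega> \<in> cocycles n r d f (2 * int n) 0 (int n) \<Longrightarrow>
      \<exists>c. \<omega> - (\<lambda>_. mconst c) * \<gamma> \<in> coboundaries n r d f (2 * int n) 0 (int n)"
proof -
  interpret Q: form_quotient "cocycles n r d f (2 * int n) 0 (int n)" "coboundaries n r d f (2 * int n) 0 (int n)"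
    by (rule form_quotient)
  have "one_dim 0 (2 * int n) 0 (int n)"
    using all_levels[of 0] by simp
  then obtain \<gamma> where \<gamma>: "\<gamma> \<in> cocycles_mod 0 (2 * int n) 0 (int n)" "\<gamma> \<notin> coboundaries_mod 0"
    and span: "\<And>\<omega>. \<omega> \<in> cocycles_mod 0 (2 * int n) 0 (int n) \<Longrightarrow> \<exists>c. \<omega> - (\<lambda>_. mconst c) * \<gamma> \<in> coboundaries_mod 0"
    unfolding one_dim_def by blast
  \<comment> \<open>By \<open>coboundaries_eq\<close> a bihomogeneous coboundary must also be a
    cocycle of the same bidegree.\<close>
  have "\<omega> - (\<lambda>_. mconst c) * \<gamma> \<in> cocycles_mod 0 (2 * int n) 0 (int n)" if "\<omega> \<in> cocycles_mod 0 (2 * int n) 0 (int n)" for \<omega> c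
    using Q.V_add[OF _ Q.V_uminus[OF Q.V_scale]] that \<gamma>(1) unfolding cocycles_eq diff_conv_add_uminus by blast
  with \<gamma> span show ?thesis
    using that[of \<gamma>] unfolding cocycles_eq coboundaries_eq by blast
qed

end

theorem proposition6p8:
  fixes n r :: nat
    and d :: "nat \<Rightarrow> nat"
    and f :: "nat \<Rightarrow> 'k::field mpol"
  assumes "n \<ge> 1" and "r \<ge> 1"
    and "\<And>j. j < r \<Longrightarrow> mvars (f j) \<subseteq> {..<n}"
    and "\<And>j. j < r \<Longrightarrow> d j \<ge> 1"
    and "\<And>j. j < r \<Longrightarrow> mhomogeneous (d j) (f j)"
    and "no_common_zero n r f"
  shows "(\<forall>k p. k \<noteq> 2 * int n \<longrightarrow>
            carrier (cohomology n r d f k 0 p) = {\<zero>\<^bsub>cohomology n r d f k 0 p\<^esub>}) \<and>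
         (\<forall>p. vectorspace.fin_dim class_ring (cohomology n r d f (2 * int n) 0 p) \<and>
            vectorspace.dim class_ring (cohomology n r d f (2 * int n) 0 p)
              = (if p = int n then 1 else 0))"
proof -
  have "\<And>j m. j < r \<Longrightarrow> m \<in> keys (f j) \<Longrightarrow> wdeg (\<lambda>_. 1) m = int (d j)"
    using assms(5) by (simp add: mhomogeneous_wdeg)
  with assms(3,6) obtain N h where
    "1 \<le> N" "\<And>l j. l < n \<Longrightarrow> j < r \<Longrightarrow> mvars (h l j :: 'k mpol) \<subseteq> {..<n}"
    "\<And>l j m. l < n \<Longrightarrow> j < r \<Longrightarrow> m \<in> keys (h l j) \<Longrightarrow> wdeg (\<lambda>_. 1) m + int (d j) = int N"
    "\<And>l. l < n \<Longrightarrow> mvar l ^ N = (\<Sum>j<r. h l j * f j)"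
    using nullstellensatz_certificate_exists[of r f n d] by blast
  then interpret nullstellensatz_certificate n r N d f h
    using assms(3,4,5) by unfold_locales auto
  show ?thesis
  proof (intro conjI allI impI)
    fix k p :: int assume "k \<noteq> 2 * int n"
    then have "cocycles n r d f k 0 p \<subseteq> coboundaries n r d f k 0 p"
      by (intro cohomology_vanishing) simp
    then show "carrier (cohomology n r d f k 0 p) = {\<zero>\<^bsub>cohomology n r d f k 0 p\<^esub>}"
      unfolding cohomology_def by (rule form_quotient.trivial_Q[OF form_quotient])
  next
    fix p
    interpret Q: form_quotient "cocycles n r d f (2 * int n) 0 p" "coboundaries n r d f (2 * int n) 0 p"
      by (rule form_quotient)
    \<comment> \<open>For p = n this is the generator of the cohomology; otherwise every cocycle is
      a coboundary and \<gamma> = 0 serves.\<close>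
    obtain \<gamma> where \<gamma>: "\<gamma> \<in> cocycles n r d f (2 * int n) 0 p"
        "\<gamma> \<in> coboundaries n r d f (2 * int n) 0 p \<longleftrightarrow> p \<noteq> int n"
      and span: "\<And>\<omega>. \<omega> \<in> cocycles n r d f (2 * int n) 0 p \<Longrightarrow>
        \<exists>c. \<omega> - (\<lambda>_. mconst c) * \<gamma> \<in> coboundaries n r d f (2 * int n) 0 p"
    proof (cases "p = int n")
      case True
      then show ?thesis
        using cohomology_one_dim that by metis
    next
      case False
      then have "cocycles n r d f (2 * int n) 0 p \<subseteq> coboundaries n r d f (2 * int n) 0 p"
        by (intro cohomology_vanishing) simp
      with False show ?thesis
        using that[of 0] Q.V_0 Q.W_0 by auto
    qed
    from Q.fin_dim_Q[OF \<gamma>(1) span] \<gamma>(2)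
    show "vectorspace.fin_dim class_ring (cohomology n r d f (2 * int n) 0 p)"
      and "vectorspace.dim class_ring (cohomology n r d f (2 * int n) 0 p) = (if p = int n then 1 else 0)"
      unfolding cohomology_def by auto
  qed
qed

end
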